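(* Let $(\mathcal{X}\times\mathcal{Y},\sigma_{XY},P_{XY})$ be a probability space with associated (marginal) probability spaces $(\mathcal{X},\sigma_X,P_X)$ and $(\mathcal{Y},\sigma_Y,P_Y)$, where $\sigma_{XY}$ is the product sigma-algebra. 1) If $P_{XY}\ll P_X\times P_Y$ and $\sigma_X$ is generated by a countable collection of sets, then $$\mathcal{L}(X\to Y)=\log\int_{\mathcal{Y}}\operatorname*{ess\,sup}_{P_X}f(X,y)\,P_Y(dy),\qquad f(x,y)=\frac{dP_{XY}}{d(P_X\times P_Y)}(x,y).$$ 2) If the absolute continuity $P_{XY}\ll P_X\times P_Y$ fails, then $\mathcal{L}(X\to Y)=+\infty$.
   Context: $\log$ is the natural logarithm. Dashes denote Markov chains. The maximal leakage is $$\mathcal{L}(X\to Y)=\sup_{U-X-Y-\hat U}\log\frac{\Pr(U=\hat U)}{\max_{u}P_U(u)},$$ the supremum being over all $U,\hat U$ taking values in the same finite, but arbitrary, alphabet. For measurable $h:\mathcal{X}\to\mathbb{R}$, $\operatorname{ess\,sup}_{P_X}h(X)=\inf\{\alpha: P_X(\{x:h(x)>\alpha\})=0\}$. *)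

theory Defs
  imports "HOL-Probability.Probability"
begin

definition ln_ext :: "ennreal \<Rightarrow> ereal" where
  "ln_ext t = (if t = 0 then -\<infinity> else if t = \<infinity> then \<infinity> else ereal (ln (enn2real t)))"

definition countably_generated :: "'a measure \<Rightarrow> bool" where
  "countably_generated M \<longleftrightarrow>
     (\<exists>G. countable G \<and> G \<subseteq> Pow (space M) \<and> sets M = sigma_sets (space M) G)"

text \<open>\<open>A - B - C\<close>: conditional independence of \<open>A\<close> and \<open>C\<close> given the sigma-algebra generated
  by \<open>B\<close>, i.e. \<open>P(A \<in> S, C \<in> T | B) = P(A \<in> S | B) P(C \<in> T | B)\<close> almost surely.\<close>

definition markov_chain3 ::
  "'w measure \<Rightarrow> 'a measure \<Rightarrow> ('w \<Rightarrow> 'a) \<Rightarrow> 'b measure \<Rightarrow> ('w \<Rightarrow> 'b) \<Rightarrow> 'c measure \<Rightarrow> ('w \<Rightarrow> 'c) \<Rightarrow> bool"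
where
  "markov_chain3 M MA A MB B MC C \<longleftrightarrow>
     A \<in> measurable M MA \<and> B \<in> measurable M MB \<and> C \<in> measurable M MC \<and>
     (\<forall>S\<in>sets MA. \<forall>T\<in>sets MC. AE w in M.
        real_cond_exp M (vimage_algebra (space M) B MB) (\<lambda>w. indicator S (A w) * indicator T (C w)) w
        = real_cond_exp M (vimage_algebra (space M) B MB) (\<lambda>w. indicator S (A w)) w
          * real_cond_exp M (vimage_algebra (space M) B MB) (\<lambda>w. indicator T (C w)) w)"

text \<open>\<open>A - B - C - D\<close>: past and future are independent given the present, at both
  interior times.\<close>

definition markov_chain4 ::
  "'w measure \<Rightarrow> 'a measure \<Rightarrow> ('w \<Rightarrow> 'a) \<Rightarrow> 'b measure \<Rightarrow> ('w \<Rightarrow> 'b)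
    \<Rightarrow> 'c measure \<Rightarrow> ('w \<Rightarrow> 'c) \<Rightarrow> 'd measure \<Rightarrow> ('w \<Rightarrow> 'd) \<Rightarrow> bool"
where
  "markov_chain4 M MA A MB B MC C MD D \<longleftrightarrow>
     markov_chain3 M MA A MB B (MC \<Otimes>\<^sub>M MD) (\<lambda>w. (C w, D w)) \<and>
     markov_chain3 M (MA \<Otimes>\<^sub>M MB) (\<lambda>w. (A w, B w)) MC C MD D"

text \<open>The possible joint laws of \<open>(U, X, Y, U')\<close> with \<open>U - X - Y - U'\<close>, where
  \<open>(X, Y)\<close> has law \<open>P\<close> and \<open>U\<close>, \<open>U'\<close> take values in the finite alphabet \<open>A\<close>. Every quantity
  in the definition of leakage depends on the joint law only, so the coordinates of the
  product space may serve as the random variables.\<close>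

definition guessing_laws ::
  "'x measure \<Rightarrow> 'y measure \<Rightarrow> ('x \<times> 'y) measure \<Rightarrow> 'u set \<Rightarrow> ('u \<times> 'x \<times> 'y \<times> 'u) measure set"
where
  "guessing_laws MX MY P A =
     {Q. prob_space Q
       \<and> sets Q = sets (count_space A \<Otimes>\<^sub>M MX \<Otimes>\<^sub>M MY \<Otimes>\<^sub>M count_space A)
       \<and> distr Q (MX \<Otimes>\<^sub>M MY) (\<lambda>(u, x, y, v). (x, y)) = P
       \<and> markov_chain4 Q (count_space A) (\<lambda>(u, x, y, v). u) MX (\<lambda>(u, x, y, v). x)
           MY (\<lambda>(u, x, y, v). y) (count_space A) (\<lambda>(u, x, y, v). v)}"

definition guessing_gain :: "'u set \<Rightarrow> ('u \<times> 'x \<times> 'y \<times> 'u) measure \<Rightarrow> ereal" where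
  "guessing_gain A Q =
     ln_ext (ennreal (measure Q {(u, x, y, v) \<in> space Q. u = v}
       / Max ((\<lambda>a. measure Q {(u, x, y, v) \<in> space Q. u = a}) ` A)))"

text \<open>Any finite alphabet can be relabelled as a finite set of natural numbers.\<close>

definition maximal_leakage ::
  "'x measure \<Rightarrow> 'y measure \<Rightarrow> ('x \<times> 'y) measure \<Rightarrow> ereal"
where
  "maximal_leakage MX MY P =
     Sup {guessing_gain A Q | (A :: nat set) Q.
            finite A \<and> A \<noteq> {} \<and> Q \<in> guessing_laws MX MY P A}"

end

theory Submission
  imports Defs
begin

text \<open>
  Upper bound: \<open>U - X - Y - V\<close> yields kernels \<open>h\<close> on \<open>X\<close> and \<open>g\<close> on \<open>Y\<close> with
  \<open>P(U = a, V = a) = \<integral> h(x) g(y) f(x,y) dP\<^sub>X dP\<^sub>Y\<close>, which is at most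
  \<open>P(U = a) E[1(V = a) F(Y)]\<close>, where \<open>F(y) = ess sup f(X,y)\<close>; now sum over \<open>a\<close>.

  Lower bound: let \<open>w\<^sub>0, ..., w\<^sub>n\<close> be bounded nonnegative functions of \<open>x\<close> with integral at most
  \<open>1\<close>. Let \<open>U = i\<close> with conditional probability \<open>\<epsilon> w\<^sub>i(x)\<close> given \<open>X = x\<close>, the remaining mass being
  spread over so many further letters that none has probability above \<open>\<epsilon>\<close>. Guessing
  \<open>V = k(Y)\<close> has gain at least \<open>E[w\<^bsub>k(Y)\<^esub>(X)]\<close>. If \<open>P\<^bsub>XY\<^esub>\<close> has density \<open>f\<close>, take
  \<open>w\<^sub>i(x) = 1(x \<in> A\<^sub>i) / P\<^sub>X(A\<^sub>i)\<close> with \<open>A\<^sub>i\<close> from a countable algebra generating the sigma-algebra of \<open>X\<close>: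
  the essential supremum is the supremum of the averages over the \<open>A\<^sub>i\<close>.
  If absolute continuity fails, approximate a product-null set of positive \<open>P\<^bsub>XY\<^esub>\<close>-measure by a set
  with finitely many distinct sections \<open>s(y)\<close>, most of which are \<open>P\<^sub>X\<close>-small, and take
  \<open>w(x) = K 1(x \<in> s(y))\<close> where \<open>P\<^sub>X(s(y)) \<le> 1/K\<close>.
\<close>

section \<open>Markov chains and kernels\<close>

text \<open>Doob-Dynkin factorisation. For indicators it holds because every set of the pulled-back
  sigma-algebra is a preimage under \<open>B\<close>; multiples, sums and monotone limits inherit
  it. It turns conditional probabilities given \<open>B\<close> into kernels.\<close>

lemma borel_measurable_vimage_algebra_factor:
  fixes f :: "'a \<Rightarrow> ennreal"
  assumes B: "B \<in> X \<rightarrow> space N" and f: "f \<in> borel_measurable (vimage_algebra X B N)"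
  shows "\<exists>g\<in>borel_measurable N. \<forall>x\<in>X. f x = g (B x)"
  using f
proof (induction rule: borel_measurable_induct)
  case (cong f g)
  then show ?case by force
next
  case (set A)
  then obtain A' where "A' \<in> sets N" "A = B -` A' \<inter> X"
    using B by (auto simp: sets_vimage_algebra2)
  then show ?case
    by (intro bexI[of _ "indicator A'"]) (auto simp: indicator_def)
next
  case (mult u c)
  then obtain g where "g \<in> borel_measurable N" "\<forall>x\<in>X. u x = g (B x)" by blast
  then show ?case by (intro bexI[of _ "\<lambda>y. c * g y"]) auto
next
  case (add u v)
  then obtain g h where "g \<in> borel_measurable N" "\<forall>x\<in>X. u x = g (B x)"
    "h \<in> borel_measurable N" "\<forall>x\<in>X. v x = h (B x)" by blast
  then show ?case by (intro bexI[of _ "\<lambda>y. h y + g y"]) auto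
next
  case (seq U)
  then obtain g where g: "\<And>i. g i \<in> borel_measurable N" "\<And>i. \<forall>x\<in>X. U i x = g i (B x)"
    by metis
  then show ?case
    by (intro bexI[of _ "\<lambda>y. SUP i. g i y"]) (auto simp: SUP_apply image_comp)
qed

lemma (in prob_space) subalgebra_vimage_algebra:
  assumes "B \<in> measurable M N"
  shows "finite_measure_subalgebra M (vimage_algebra (space M) B N)"
proof
  show "subalgebra M (vimage_algebra (space M) B N)"
    using assms measurable_space[OF assms]
    by (auto simp: subalgebra_def sets_vimage_algebra2 measurable_sets)
qed

lemma markov_chain3_sym:
  assumes "markov_chain3 M MA A MB B MC C"
  shows "markov_chain3 M MC C MB B MA A"
  using assms unfolding markov_chain3_def by (auto simp: mult.commute)

text \<open>Both sides integrate \<open>\<phi>\<close> against the laws of \<open>(B, C)\<close>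
  under the measures with densities \<open>f\<close> and \<open>g\<close>. These laws agree on
  rectangles, an intersection-stable generator containing the whole space, whose mass is finite by
  \<open>fin\<close>; so they are equal.\<close>

lemma (in prob_space) nn_integral_pair_eqI:
  assumes [measurable]: "B \<in> measurable M MB" "C \<in> measurable M MC"
    "f \<in> borel_measurable M" "g \<in> borel_measurable M"
  and fin: "(\<integral>\<^sup>+w. f w \<partial>M) \<noteq> \<infinity>"
  and eq: "\<And>E T. E \<in> sets MB \<Longrightarrow> T \<in> sets MC \<Longrightarrow>
    (\<integral>\<^sup>+w. f w * (indicator E (B w) * indicator T (C w)) \<partial>M)
      = (\<integral>\<^sup>+w. g w * (indicator E (B w) * indicator T (C w)) \<partial>M)"
  and [measurable]: "\<phi> \<in> borel_measurable (MB \<Otimes>\<^sub>M MC)"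
  shows "(\<integral>\<^sup>+w. f w * \<phi> (B w, C w) \<partial>M) = (\<integral>\<^sup>+w. g w * \<phi> (B w, C w) \<partial>M)"
proof -
  let ?D = "\<lambda>f. distr (density M f) (MB \<Otimes>\<^sub>M MC) (\<lambda>w. (B w, C w))"
  have em: "emeasure (?D h) (E \<times> T) = (\<integral>\<^sup>+w. h w * (indicator E (B w) * indicator T (C w)) \<partial>M)"
    if [measurable]: "h \<in> borel_measurable M" "E \<in> sets MB" "T \<in> sets MC" for h E T
    by (simp add: emeasure_distr emeasure_density)
       (intro nn_integral_cong, auto simp: indicator_def)
  have "?D f = ?D g"
  proof (rule measure_eqI_generator_eq[OF Int_stable_pair_measure_generator pair_measure_closed,
      where A="\<lambda>_. space MB \<times> space MC"])
    fix X assume "X \<in> {a \<times> b |a b. a \<in> sets MB \<and> b \<in> sets MC}"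
    then show "emeasure (?D f) X = emeasure (?D g) X" using em eq by auto
  next
    have "emeasure (?D f) (space MB \<times> space MC) = (\<integral>\<^sup>+w. f w \<partial>M)"
      by (subst em) (auto intro!: nn_integral_cong simp: measurable_space indicator_def
          measurable_space[OF assms(1)] measurable_space[OF assms(2)])
    then show "\<And>i. emeasure (?D f) (space MB \<times> space MC) \<noteq> \<infinity>" using fin by simp
  qed (auto simp: sets_pair_measure)
  moreover have "(\<integral>\<^sup>+w. h w * \<phi> (B w, C w) \<partial>M) = (\<integral>\<^sup>+z. \<phi> z \<partial>?D h)"
    if [measurable]: "h \<in> borel_measurable M" for h
    by (simp add: nn_integral_distr nn_integral_density)
  ultimately show ?thesis by simp
qed

text \<open>The kernel \<open>g\<close> is a version of the conditional probability of
  \<open>A \<in> S\<close> given \<open>B\<close>. Given \<open>B\<close>, the variable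
  \<open>C\<close> adds no information about \<open>A\<close>, so \<open>g (B w)\<close> may replace
  the indicator even against functions of \<open>(B, C)\<close>.\<close>

lemma (in prob_space) markov_chain3_kernel:
  assumes mc: "markov_chain3 M MA A MB B MC C" and S: "S \<in> sets MA"
  shows "\<exists>g\<in>borel_measurable MB. \<forall>\<phi>\<in>borel_measurable (MB \<Otimes>\<^sub>M MC).
    (\<integral>\<^sup>+w. indicator S (A w) * \<phi> (B w, C w) \<partial>M) = (\<integral>\<^sup>+w. g (B w) * \<phi> (B w, C w) \<partial>M)"
proof -
  have [measurable]: "A \<in> measurable M MA" "B \<in> measurable M MB" "C \<in> measurable M MC" "S \<in> sets MA"
    using mc S by (auto simp: markov_chain3_def)
  let ?F = "vimage_algebra (space M) B MB"
  interpret F: finite_measure_subalgebra M ?F by (rule subalgebra_vimage_algebra) fact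
  define a where "a = real_cond_exp M ?F (\<lambda>w. indicator S (A w))"
  have BM: "B \<in> measurable ?F MB"
    using measurable_space[OF \<open>B \<in> measurable M MB\<close>] by (intro measurable_vimage_algebra1) auto
  have aF: "a \<in> borel_measurable ?F" unfolding a_def by simp
  have [measurable]: "a \<in> borel_measurable M" unfolding a_def by simp
  have int_ind: "integrable M (\<lambda>w. indicator S (A w) :: real)"
    by (intro integrable_const_bound[where B=1]) auto
  have int_a: "integrable M a" unfolding a_def using int_ind by (rule F.real_cond_exp_int)
  have a_nonneg: "AE w in M. 0 \<le> a w" unfolding a_def
    by (rule F.real_cond_exp_pos) auto
  \<comment> \<open>Conditioning on \<open>B\<close> leaves \<open>?E\<close> alone, as it is
    measurable for \<open>?F\<close>; the Markov property factorises the rest; and \<open>?b\<close>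
    is unconditioned again because its cofactor \<open>a w * ?E w\<close> is measurable for
    \<open>?F\<close>.\<close>
  have rect: "(\<integral>w. indicator S (A w) * (indicator E (B w) * indicator T (C w)) \<partial>M)
     = (\<integral>w. a w * (indicator E (B w) * indicator T (C w)) \<partial>M)" 
    if [measurable]: "E \<in> sets MB" "T \<in> sets MC" for E T
  proof -
    let ?b = "real_cond_exp M ?F (\<lambda>w. indicator T (C w))"
    let ?E = "\<lambda>w. indicator E (B w) :: real"
    have EF: "?E \<in> borel_measurable ?F" by (rule measurable_compose[OF BM]) simp
    have aEF: "(\<lambda>w. a w * ?E w) \<in> borel_measurable ?F" using aF EF by simp
    have i1: "integrable M (\<lambda>w. ?E w * (indicator S (A w) * indicator T (C w)))"
      by (rule integrable_const_bound[where B=1]) (auto simp: indicator_def)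
    have i2: "integrable M (\<lambda>w. a w * ?E w * indicator T (C w))"
      by (rule Bochner_Integration.integrable_bound[OF int_a]) (auto simp: indicator_def)
    have "(\<integral>w. ?E w * (indicator S (A w) * indicator T (C w)) \<partial>M)
      = (\<integral>w. ?E w * real_cond_exp M ?F (\<lambda>w. indicator S (A w) * indicator T (C w)) w \<partial>M)"
      by (rule F.real_cond_exp_intg(2)[symmetric]) (use i1 EF in auto)
    also have "\<dots> = (\<integral>w. (a w * ?E w) * ?b w \<partial>M)"
    proof (rule integral_cong_AE)
      have "AE w in M. real_cond_exp M ?F (\<lambda>w. indicator S (A w) * indicator T (C w)) w = a w * ?b w"
        using mc that S unfolding markov_chain3_def a_def by blast
      then show "AE w in M. ?E w * real_cond_exp M ?F (\<lambda>w. indicator S (A w) * indicator T (C w)) w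
          = (a w * ?E w) * ?b w" by eventually_elim simp
    qed auto
    also have "\<dots> = (\<integral>w. (a w * ?E w) * indicator T (C w) \<partial>M)"
      by (rule F.real_cond_exp_intg(2)) (use i2 aEF in auto)
    finally show ?thesis by (simp add: mult_ac)
  qed
  \<comment> \<open>\<open>ennreal\<close> sends negative values of \<open>a\<close> to
    \<open>0\<close>; they occur only on a null set, so no integral changes.\<close>
  obtain g where g[measurable]: "g \<in> borel_measurable MB" and ga: "\<And>w. w \<in> space M \<Longrightarrow> ennreal (a w) = g (B w)"
    using borel_measurable_vimage_algebra_factor[of B "space M" MB "\<lambda>w. ennreal (a w)"] aF
      measurable_space[OF \<open>B \<in> measurable M MB\<close>] by (auto simp: Pi_iff)
  show ?thesis
  proof (intro bexI[OF _ g] ballI nn_integral_pair_eqI)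
    show "(\<integral>\<^sup>+w. indicator S (A w) \<partial>M) \<noteq> \<infinity>"
    proof -
      have "(\<integral>\<^sup>+w. indicator S (A w) \<partial>M) \<le> (\<integral>\<^sup>+w. 1 \<partial>M)"
        by (intro nn_integral_mono) (auto simp: indicator_def)
      then show ?thesis by (auto simp: emeasure_space_1 top_unique)
    qed
    fix E T assume [measurable]: "E \<in> sets MB" "T \<in> sets MC"
    have "(\<integral>\<^sup>+w. indicator S (A w) * (indicator E (B w) * indicator T (C w)) \<partial>M)
      = (\<integral>\<^sup>+w. ennreal (indicator S (A w) * (indicator E (B w) * indicator T (C w))) \<partial>M)"
      by (intro nn_integral_cong) (auto simp: indicator_def)
    also have "\<dots> = (\<integral>w. indicator S (A w) * (indicator E (B w) * indicator T (C w)) \<partial>M)"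
      by (intro nn_integral_eq_integral integrable_const_bound[where B=1])
         (auto simp: indicator_def)
    also have "\<dots> = (\<integral>w. a w * (indicator E (B w) * indicator T (C w)) \<partial>M)"
      by (subst rect) auto
    also have "\<dots> = (\<integral>\<^sup>+w. ennreal (a w * (indicator E (B w) * indicator T (C w))) \<partial>M)"
      by (intro nn_integral_eq_integral[symmetric] Bochner_Integration.integrable_bound[OF int_a])
         (use a_nonneg in \<open>auto simp: indicator_def\<close>)
    also have "\<dots> = (\<integral>\<^sup>+w. g (B w) * (indicator E (B w) * indicator T (C w)) \<partial>M)"
      by (intro nn_integral_cong) (auto simp: indicator_def ga)
    finally show "(\<integral>\<^sup>+w. indicator S (A w) * (indicator E (B w) * indicator T (C w)) \<partial>M)
      = (\<integral>\<^sup>+w. g (B w) * (indicator E (B w) * indicator T (C w)) \<partial>M)" .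
  qed auto
qed

text \<open>Converse of the kernel lemma: an \<open>h\<close> reproducing all rectangle integrals
  must be the conditional probability of \<open>A \<in> S\<close> given \<open>B\<close>, and as a
  function of \<open>B\<close> it can be pulled out of conditional expectations. Its bound supplies
  integrability.\<close>

lemma (in prob_space) markov_chain3I:
  assumes [measurable]: "A \<in> measurable M MA" "B \<in> measurable M MB" "C \<in> measurable M MC"
  and ker: "\<And>S. S \<in> sets MA \<Longrightarrow> \<exists>h\<in>borel_measurable MB. (\<forall>b\<in>space MB. \<bar>h b\<bar> \<le> (1::real)) \<and>
    (\<forall>E\<in>sets MB. \<forall>T\<in>sets MC. (\<integral>w. indicator S (A w) * (indicator E (B w) * indicator T (C w)) \<partial>M)
      = (\<integral>w. h (B w) * (indicator E (B w) * indicator T (C w)) \<partial>M))"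
  shows "markov_chain3 M MA A MB B MC C"
  unfolding markov_chain3_def
proof (intro conjI ballI)
  fix S T assume S[measurable]: "S \<in> sets MA" and T[measurable]: "T \<in> sets MC"
  let ?F = "vimage_algebra (space M) B MB"
  interpret F: finite_measure_subalgebra M ?F by (rule subalgebra_vimage_algebra) fact
  have BM: "B \<in> measurable ?F MB"
    using measurable_space[OF \<open>B \<in> measurable M MB\<close>] by (intro measurable_vimage_algebra1) auto
  obtain h where h[measurable]: "h \<in> borel_measurable MB" and h1: "\<And>b. b \<in> space MB \<Longrightarrow> \<bar>h b\<bar> \<le> (1::real)"
    and hE: "\<And>E T. E \<in> sets MB \<Longrightarrow> T \<in> sets MC \<Longrightarrow>
      (\<integral>w. indicator S (A w) * (indicator E (B w) * indicator T (C w)) \<partial>M)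
      = (\<integral>w. h (B w) * (indicator E (B w) * indicator T (C w)) \<partial>M)"
    using ker[OF S] by blast
  have hF: "(\<lambda>w. h (B w)) \<in> borel_measurable ?F" by (rule measurable_compose[OF BM]) simp
  have h2: "w \<in> space M \<Longrightarrow> \<bar>h (B w)\<bar> \<le> 1" for w
    using h1 measurable_space[OF \<open>B \<in> measurable M MB\<close>] by auto
  have inth: "integrable M (\<lambda>w. h (B w))"
    by (rule integrable_const_bound[where B=1]) (use h2 in auto)
  \<comment> \<open>Sets of \<open>?F\<close> are preimages under \<open>B\<close>, so the rectangle
    identity is exactly the characterisation of a conditional expectation.\<close>
  have c: "AE w in M. real_cond_exp M ?F (\<lambda>w. indicator S (A w) * indicator T (C w)) w
      = h (B w) * real_cond_exp M ?F (\<lambda>w. indicator T (C w)) w" if [measurable]: "T \<in> sets MC" for T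
  proof -
    have int: "integrable M (\<lambda>w. h (B w) * indicator T (C w))"
      by (rule Bochner_Integration.integrable_bound[OF inth]) (auto simp: indicator_def)
    have "AE w in M. real_cond_exp M ?F (\<lambda>w. indicator S (A w) * indicator T (C w)) w
      = real_cond_exp M ?F (\<lambda>w. h (B w) * indicator T (C w)) w"
    proof (rule F.real_cond_exp_charact)
      fix E' assume "E' \<in> sets ?F"
      then obtain E where E: "E \<in> sets MB" "E' = B -` E \<inter> space M"
        using measurable_space[OF \<open>B \<in> measurable M MB\<close>] by (auto simp: sets_vimage_algebra2 Pi_iff)
      have "(\<integral>w\<in>E'. (indicator S (A w) * indicator T (C w) :: real) \<partial>M)
        = (\<integral>w. indicator S (A w) * (indicator E (B w) * indicator T (C w)) \<partial>M)"
        unfolding set_lebesgue_integral_def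
        by (intro Bochner_Integration.integral_cong refl) (auto simp: E indicator_def)
      also have "\<dots> = (\<integral>w. h (B w) * (indicator E (B w) * indicator T (C w)) \<partial>M)"
        using E(1) that by (rule hE)
      also have "\<dots> = (\<integral>w\<in>E'. h (B w) * indicator T (C w) \<partial>M)"
        unfolding set_lebesgue_integral_def
        by (intro Bochner_Integration.integral_cong refl) (auto simp: E indicator_def)
      also have "\<dots> = (\<integral>w\<in>E'. real_cond_exp M ?F (\<lambda>w. h (B w) * indicator T (C w)) w \<partial>M)"
        by (rule F.real_cond_exp_intA[OF int \<open>E' \<in> sets ?F\<close>])
      finally show "(\<integral>w\<in>E'. indicator S (A w) * indicator T (C w) \<partial>M)
        = (\<integral>w\<in>E'. real_cond_exp M ?F (\<lambda>w. h (B w) * indicator T (C w)) w \<partial>M)" .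
    next
      show "integrable M (\<lambda>w. indicator S (A w) * indicator T (C w) :: real)"
        by (rule integrable_const_bound[where B=1]) (auto simp: indicator_def)
      show "integrable M (real_cond_exp M ?F (\<lambda>w. h (B w) * indicator T (C w)))"
        by (rule F.real_cond_exp_int(1)[OF int])
    qed simp
    moreover have "AE w in M. real_cond_exp M ?F (\<lambda>w. h (B w) * indicator T (C w)) w
      = h (B w) * real_cond_exp M ?F (\<lambda>w. indicator T (C w)) w"
      by (rule F.real_cond_exp_mult[OF hF _ int]) simp
    ultimately show ?thesis by eventually_elim simp
  qed
  \<comment> \<open>The case in which \<open>T\<close> is the whole space identifies
    \<open>h (B w)\<close> itself as the conditional probability.\<close>
  have "AE w in M. real_cond_exp M ?F (\<lambda>w. indicator S (A w)) w = h (B w)"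
  proof (rule F.real_cond_exp_charact)
    fix E' assume "E' \<in> sets ?F"
    then obtain E where E: "E \<in> sets MB" "E' = B -` E \<inter> space M"
      using measurable_space[OF \<open>B \<in> measurable M MB\<close>] by (auto simp: sets_vimage_algebra2 Pi_iff)
    have C: "w \<in> space M \<Longrightarrow> C w \<in> space MC" for w
      using measurable_space[OF \<open>C \<in> measurable M MC\<close>] by auto
    have "(\<integral>w\<in>E'. (indicator S (A w) :: real) \<partial>M)
      = (\<integral>w. indicator S (A w) * (indicator E (B w) * indicator (space MC) (C w)) \<partial>M)"
      unfolding set_lebesgue_integral_def
      by (intro Bochner_Integration.integral_cong refl) (use C in \<open>auto simp: E indicator_def\<close>)
    also have "\<dots> = (\<integral>w. h (B w) * (indicator E (B w) * indicator (space MC) (C w)) \<partial>M)"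
      using E(1) by (rule hE) simp
    also have "\<dots> = (\<integral>w\<in>E'. h (B w) \<partial>M)"
      unfolding set_lebesgue_integral_def
      by (intro Bochner_Integration.integral_cong refl) (use C in \<open>auto simp: E indicator_def\<close>)
    finally show "(\<integral>w\<in>E'. indicator S (A w) \<partial>M) = (\<integral>w\<in>E'. h (B w) \<partial>M)" .
  next
    show "integrable M (\<lambda>w. indicator S (A w) :: real)"
      by (rule integrable_const_bound[where B=1]) (auto simp: indicator_def)
  qed (fact inth hF)+
  with c[OF T] show "AE w in M. real_cond_exp M ?F (\<lambda>w. indicator S (A w) * indicator T (C w)) w
        = real_cond_exp M ?F (\<lambda>w. indicator S (A w)) w
          * real_cond_exp M ?F (\<lambda>w. indicator T (C w)) w"
    by eventually_elim simp
qed fact+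

section \<open>The upper bound\<close>

lemma ln_ext_le_ereal_iff: "ln_ext t \<le> ereal r \<longleftrightarrow> t \<le> ennreal (exp r)"
proof (cases t)
  case (real x)
  then show ?thesis
    by (cases "x = 0") (auto simp: ln_ext_def ln_le_cancel_iff[symmetric] simp del: ln_le_cancel_iff)
qed (auto simp: ln_ext_def top_unique)

text \<open>A finite bound on a logarithm is a bound by an exponential, which passes to suprema; the
  bound \<open>-\<infinity>\<close> forces every \<open>v i\<close> to vanish. This carries leakage
  bounds from approximating guesses to their limit.\<close>

lemma ln_ext_le_SUP:
  fixes v :: "'i \<Rightarrow> ennreal"
  assumes le: "\<And>i. ln_ext (v i) \<le> z" and t: "t \<le> (SUP i. v i)"
  shows "ln_ext t \<le> z"
proof (cases z)
  case (real r)
  have "(SUP i. v i) \<le> ennreal (exp r)"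
    using le by (intro SUP_least) (simp add: real ln_ext_le_ereal_iff)
  then show ?thesis using t by (simp add: real ln_ext_le_ereal_iff)
next
  case MInf
  have "v i = 0" for i using le[of i] by (auto simp: MInf ln_ext_def split: if_splits)
  then show ?thesis using t MInf by (simp add: ln_ext_def)
qed simp

lemma ln_ext_mono: "s \<le> t \<Longrightarrow> ln_ext s \<le> ln_ext t"
  by (rule ln_ext_le_SUP[of "\<lambda>_. t"]) auto

section \<open>Essential suprema of sections, and the gain of a guess\<close>

text \<open>The essential supremum exceeds \<open>c\<close> exactly when
  \<open>{x. c < f (x, y)}\<close> has positive measure, and the measure of a section is measurable
  in \<open>y\<close>.\<close>

lemma (in pair_sigma_finite) borel_measurable_esssup_section:
  fixes f :: "'a \<times> 'b \<Rightarrow> ennreal"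
  assumes [measurable]: "f \<in> borel_measurable (M1 \<Otimes>\<^sub>M M2)"
  shows "(\<lambda>y. esssup M1 (\<lambda>x. f (x, y))) \<in> borel_measurable M2"
proof (rule borel_measurableI_greater)
  fix c
  have "c < esssup M1 (\<lambda>x. f (x, y)) \<longleftrightarrow> emeasure M1 {x \<in> space M1. c < f (x, y)} \<noteq> 0"
    if [measurable]: "y \<in> space M2" for y
  proof
    assume "c < esssup M1 (\<lambda>x. f (x, y))"
    then show "emeasure M1 {x \<in> space M1. c < f (x, y)} \<noteq> 0"
      using esssup_pos_measure[of "\<lambda>x. f (x, y)" M1 c] by auto
  next
    assume *: "emeasure M1 {x \<in> space M1. c < f (x, y)} \<noteq> 0"
    show "c < esssup M1 (\<lambda>x. f (x, y))"
    proof (rule ccontr)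
      assume "\<not> c < esssup M1 (\<lambda>x. f (x, y))"
      then have "AE x in M1. \<not> c < f (x, y)"
        using esssup_AE[of "\<lambda>x. f (x, y)" M1] by (auto elim!: eventually_mono)
      with * show False by (subst (asm) AE_iff_measurable[OF _ refl]) auto
    qed
  qed
  then have "{y \<in> space M2. c < esssup M1 (\<lambda>x. f (x, y))}
    = {y \<in> space M2. emeasure M1 {x \<in> space M1. c < f (x, y)} \<noteq> 0}" by auto
  also have "\<dots> = {y \<in> space M2. emeasure M1 ((\<lambda>x. (x, y)) -` {z \<in> space (M1 \<Otimes>\<^sub>M M2). c < f z}) \<noteq> 0}"
    by (intro Collect_cong conj_cong refl arg_cong2[where f="(\<noteq>)"] arg_cong2[where f=emeasure])
       (auto simp: space_pair_measure)
  also have "\<dots> \<in> sets M2"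
    using measurable_emeasure_Pair2[of "{z \<in> space (M1 \<Otimes>\<^sub>M M2). c < f z}"] by measurable
  finally show "{y \<in> space M2. c < esssup M1 (\<lambda>x. f (x, y))} \<in> sets M2" .
qed

lemma guessing_gain_le:
  fixes PX :: "'x measure" and PY :: "'y measure" and A :: "'u set"
  assumes pXY: "prob_space PXY" and setsXY[measurable_cong]: "sets PXY = sets (MX \<Otimes>\<^sub>M MY)"
    and PX: "PX = distr PXY MX fst" and PY: "PY = distr PXY MY snd"
    and f[measurable]: "f \<in> borel_measurable (PX \<Otimes>\<^sub>M PY)"
    and dens: "density (PX \<Otimes>\<^sub>M PY) f = PXY"
    and A: "finite A" "A \<noteq> {}" and Q: "Q \<in> guessing_laws MX MY PXY A"
  shows "guessing_gain A Q \<le> ln_ext (\<integral>\<^sup>+ y. esssup PX (\<lambda>x. f (x, y)) \<partial>PY)"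
proof -
  interpret PXY: prob_space PXY by fact
  have fst': "fst \<in> measurable PXY MX" and snd': "snd \<in> measurable PXY MY"
    using setsXY by (simp_all cong: measurable_cong_sets)
  interpret PX: prob_space PX unfolding PX by (rule PXY.prob_space_distr[OF fst'])
  interpret PY: prob_space PY unfolding PY by (rule PXY.prob_space_distr[OF snd'])
  have sX[measurable_cong]: "sets PX = sets MX" and sY[measurable_cong]: "sets PY = sets MY"
    by (simp_all add: PX PY)
  interpret PP: pair_sigma_finite PX PY ..
  define F where "F y = esssup PX (\<lambda>x. f (x, y))" for y
  have F[measurable]: "F \<in> borel_measurable MY"
    using PP.borel_measurable_esssup_section[OF f] measurable_cong_sets[OF sY refl]
    unfolding F_def[abs_def] by blast
  interpret Q: prob_space Q using Q by (simp add: guessing_laws_def)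
  have sQ[measurable_cong]: "sets Q = sets (count_space A \<Otimes>\<^sub>M MX \<Otimes>\<^sub>M MY \<Otimes>\<^sub>M count_space A)"
    using Q by (simp add: guessing_laws_def)
  define U X Y V where "U = (\<lambda>(u::'u, x::'x, y::'y, v::'u). u)" and "X = (\<lambda>(u::'u, x::'x, y::'y, v::'u). x)"
    and "Y = (\<lambda>(u::'u, x::'x, y::'y, v::'u). y)" and "V = (\<lambda>(u::'u, x::'x, y::'y, v::'u). v)"
  have [measurable]: "U \<in> measurable Q (count_space A)" "X \<in> measurable Q MX"
    "Y \<in> measurable Q MY" "V \<in> measurable Q (count_space A)"
    unfolding U_def X_def Y_def V_def by measurable
  have dQ: "distr Q (MX \<Otimes>\<^sub>M MY) (\<lambda>w. (X w, Y w)) = PXY"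
    using Q by (simp add: guessing_laws_def X_def Y_def split_beta')
  have PXQ: "PX = distr Q MX X" and PYQ: "PY = distr Q MY Y"
    unfolding PX PY dQ[symmetric] by (simp_all add: distr_distr comp_def)
  have mc: "markov_chain4 Q (count_space A) U MX X MY Y (count_space A) V"
    using Q by (simp add: guessing_laws_def U_def X_def Y_def V_def)
  have spA: "w \<in> space Q \<Longrightarrow> U w \<in> A \<and> V w \<in> A" for w
    using measurable_space[of U Q "count_space A"] measurable_space[of V Q "count_space A"] by simp
  have main: "emeasure Q {w \<in> space Q. U w = a \<and> V w = a}
    \<le> emeasure Q {w \<in> space Q. U w = a} * (\<integral>\<^sup>+w. indicator {a} (V w) * F (Y w) \<partial>Q)" if "a \<in> A" for a
  proof -
    have [measurable]: "{a} \<in> sets (count_space A)" using that by simp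
    have a: "{a} \<in> sets (count_space A)" using that by simp
    \<comment> \<open>Each end of the chain is conditioned on its neighbour, with the other two
      variables as third component; for \<open>V\<close> the chain is reversed.\<close>
    have mc1: "markov_chain3 Q (count_space A) V MY Y (count_space A \<Otimes>\<^sub>M MX) (\<lambda>w. (U w, X w))"
      and mc2: "markov_chain3 Q (count_space A) U MX X (MY \<Otimes>\<^sub>M count_space A) (\<lambda>w. (Y w, V w))"
      using mc by (auto simp: markov_chain4_def intro: markov_chain3_sym)
    obtain g where g[measurable]: "g \<in> borel_measurable MY" and
      gi: "\<forall>\<phi>\<in>borel_measurable (MY \<Otimes>\<^sub>M (count_space A \<Otimes>\<^sub>M MX)).
       (\<integral>\<^sup>+w. indicator {a} (V w) * \<phi> (Y w, (U w, X w)) \<partial>Q) = (\<integral>\<^sup>+w. g (Y w) * \<phi> (Y w, (U w, X w)) \<partial>Q)"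
      using Q.markov_chain3_kernel[OF mc1 a] by (rule bexE)
    note gi = bspec[OF gi]
    obtain h where h[measurable]: "h \<in> borel_measurable MX" and
      hi: "\<forall>\<phi>\<in>borel_measurable (MX \<Otimes>\<^sub>M (MY \<Otimes>\<^sub>M count_space A)).
       (\<integral>\<^sup>+w. indicator {a} (U w) * \<phi> (X w, (Y w, V w)) \<partial>Q) = (\<integral>\<^sup>+w. h (X w) * \<phi> (X w, (Y w, V w)) \<partial>Q)"
      using Q.markov_chain3_kernel[OF mc2 a] by (rule bexE)
    note hi = bspec[OF hi]
    \<comment> \<open>First \<open>g (Y w)\<close> replaces the indicator of \<open>V = a\<close>;
      then, with \<open>g\<close> as test function, \<open>h (X w)\<close> replaces that of
      \<open>U = a\<close>. What remains depends on \<open>(X, Y)\<close> only.\<close>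
    have "emeasure Q {w \<in> space Q. U w = a \<and> V w = a} = (\<integral>\<^sup>+w. indicator {w \<in> space Q. U w = a \<and> V w = a} w \<partial>Q)"
      by simp
    also have "\<dots> = (\<integral>\<^sup>+w. indicator {a} (V w) * indicator {a} (U w) \<partial>Q)"
      by (intro nn_integral_cong) (auto simp: indicator_def)
    also have "\<dots> = (\<integral>\<^sup>+w. g (Y w) * indicator {a} (U w) \<partial>Q)"
      using gi[of "\<lambda>(y, u, x). indicator {a} u"] by simp
    also have "\<dots> = (\<integral>\<^sup>+w. indicator {a} (U w) * g (Y w) \<partial>Q)" by (simp add: mult.commute)
    also have "\<dots> = (\<integral>\<^sup>+w. h (X w) * g (Y w) \<partial>Q)"
      using hi[of "\<lambda>(x, y, v). g y"] by simp
    also have "\<dots> = (\<integral>\<^sup>+z. h (fst z) * g (snd z) \<partial>PXY)"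
      unfolding dQ[symmetric] by (simp add: nn_integral_distr)
    also have "\<dots> = (\<integral>\<^sup>+z. f z * (h (fst z) * g (snd z)) \<partial>(PX \<Otimes>\<^sub>M PY))"
      unfolding dens[symmetric] by (simp add: nn_integral_density)
    also have "\<dots> = (\<integral>\<^sup>+y. \<integral>\<^sup>+x. f (x, y) * (h x * g y) \<partial>PX \<partial>PY)"
      by (subst PP.nn_integral_snd[symmetric]) auto
    \<comment> \<open>For fixed \<open>y\<close>, \<open>F y\<close> bounds \<open>f (x, y)\<close>
      for almost every \<open>x\<close>; after that the integral splits into a product.\<close>
    also have "\<dots> \<le> (\<integral>\<^sup>+y. (\<integral>\<^sup>+x. h x \<partial>PX) * (g y * F y) \<partial>PY)"
    proof (rule nn_integral_mono)
      fix y assume "y \<in> space PY"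
      have "AE x in PX. f (x, y) \<le> F y" unfolding F_def by (rule esssup_AE)
      then have "(\<integral>\<^sup>+x. f (x, y) * (h x * g y) \<partial>PX) \<le> (\<integral>\<^sup>+x. F y * (h x * g y) \<partial>PX)"
        by (intro nn_integral_mono_AE) (auto elim!: eventually_mono intro!: mult_right_mono)
      also have "\<dots> = (\<integral>\<^sup>+x. h x * (g y * F y) \<partial>PX)" by (simp add: mult_ac)
      also have "\<dots> = (\<integral>\<^sup>+x. h x \<partial>PX) * (g y * F y)" by (rule nn_integral_multc) simp
      finally show "(\<integral>\<^sup>+x. f (x, y) * (h x * g y) \<partial>PX) \<le> (\<integral>\<^sup>+x. h x \<partial>PX) * (g y * F y)" .
    qed
    also have "\<dots> = (\<integral>\<^sup>+x. h x \<partial>PX) * (\<integral>\<^sup>+y. g y * F y \<partial>PY)"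
      by (rule nn_integral_cmult) simp
    \<comment> \<open>The kernels are turned back into indicators, now with the test functions
      \<open>1\<close> and \<open>F\<close>.\<close>
    also have "(\<integral>\<^sup>+x. h x \<partial>PX) = (\<integral>\<^sup>+w. indicator {a} (U w) \<partial>Q)"
      using hi[of "\<lambda>_. 1"] unfolding PXQ by (simp add: nn_integral_distr)
    also have "\<dots> = (\<integral>\<^sup>+w. indicator {w \<in> space Q. U w = a} w \<partial>Q)"
      by (intro nn_integral_cong) (auto simp: indicator_def)
    also have "\<dots> = emeasure Q {w \<in> space Q. U w = a}" by simp
    also have "(\<integral>\<^sup>+y. g y * F y \<partial>PY) = (\<integral>\<^sup>+w. indicator {a} (V w) * F (Y w) \<partial>Q)"
      using gi[of "\<lambda>(y, u, x). F y"] unfolding PYQ by (simp add: nn_integral_distr)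
    finally show ?thesis .
  qed
  define m where "m = Max ((\<lambda>a. measure Q {w \<in> space Q. U w = a}) ` A)"
  have m: "measure Q {w \<in> space Q. U w = a} \<le> m" if "a \<in> A" for a
    unfolding m_def using A that by (intro Max_ge) auto
  have m0: "0 \<le> m" using A m by (meson all_not_in_conv measure_nonneg order_trans)
  have "emeasure Q {w \<in> space Q. U w = V w} = emeasure Q (\<Union>a\<in>A. {w \<in> space Q. U w = a \<and> V w = a})"
    using spA by (intro arg_cong2[where f=emeasure]) auto
  also have "\<dots> = (\<Sum>a\<in>A. emeasure Q {w \<in> space Q. U w = a \<and> V w = a})"
  proof (rule sum_emeasure[symmetric])
    show "(\<lambda>a. {w \<in> space Q. U w = a \<and> V w = a}) ` A \<subseteq> sets Q"
    proof safe
      fix a assume "a \<in> A"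
      then have [measurable]: "{a} \<in> sets (count_space A)" by simp
      have "{w \<in> space Q. U w \<in> {a} \<and> V w \<in> {a}} \<in> sets Q" by measurable
      then show "{w \<in> space Q. U w = a \<and> V w = a} \<in> sets Q" by simp
    qed
  qed (auto simp: disjoint_family_on_def A)
  \<comment> \<open>Each letter has probability at most \<open>m\<close>; once \<open>m\<close> is
    pulled out, the indicators of \<open>V = a\<close> add up to \<open>1\<close>.\<close>
  also have "\<dots> \<le> (\<Sum>a\<in>A. ennreal m * (\<integral>\<^sup>+w. indicator {a} (V w) * F (Y w) \<partial>Q))"
    using m by (intro sum_mono order_trans[OF main] mult_right_mono) (auto simp: Q.emeasure_eq_measure intro!: ennreal_leI)
  also have "\<dots> = ennreal m * (\<integral>\<^sup>+w. (\<Sum>a\<in>A. indicator {a} (V w) * F (Y w)) \<partial>Q)"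
  proof -
    have "(\<lambda>w. indicator {a} (V w) :: ennreal) \<in> borel_measurable Q" if "a \<in> A" for a
    proof -
      have [measurable]: "{a} \<in> sets (count_space A)" using that by simp
      show ?thesis by measurable
    qed
    then show ?thesis by (subst nn_integral_sum) (auto simp: sum_distrib_left)
  qed
  also have "(\<integral>\<^sup>+w. (\<Sum>a\<in>A. indicator {a} (V w) * F (Y w)) \<partial>Q) = (\<integral>\<^sup>+w. F (Y w) \<partial>Q)"
  proof (rule nn_integral_cong)
    fix w assume "w \<in> space Q"
    then show "(\<Sum>a\<in>A. indicator {a} (V w) * F (Y w)) = F (Y w)"
      using A spA by (subst sum.remove[of _ "V w"]) (auto simp: indicator_def intro!: sum.neutral)
  qed
  also have "\<dots> = (\<integral>\<^sup>+y. F y \<partial>PY)" unfolding PYQ by (simp add: nn_integral_distr)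
  finally have le: "ennreal (measure Q {w \<in> space Q. U w = V w}) \<le> ennreal m * (\<integral>\<^sup>+y. F y \<partial>PY)"
    by (simp add: Q.emeasure_eq_measure)
  have "ennreal (measure Q {w \<in> space Q. U w = V w} / m) \<le> (\<integral>\<^sup>+y. F y \<partial>PY)"
  \<comment> \<open>Division by \<open>0\<close> yields \<open>0\<close>, so the case
    \<open>m = 0\<close> is immediate.\<close>
  proof (cases "m = 0")
    case False
    show ?thesis
    proof (cases "\<integral>\<^sup>+y. F y \<partial>PY")
      case (real r)
      with le m0 have "measure Q {w \<in> space Q. U w = V w} \<le> m * r"
        by (simp flip: ennreal_mult)
      with real False m0 show ?thesis by (auto simp: field_simps intro!: ennreal_leI)
    qed simp
  qed simp
  then have "ln_ext (ennreal (measure Q {w \<in> space Q. U w = V w} / m)) \<le> ln_ext (\<integral>\<^sup>+y. F y \<partial>PY)"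
    by (rule ln_ext_mono)
  moreover have "{(u, x, y, v) \<in> space Q. u = v} = {w \<in> space Q. U w = V w}"
    "\<And>a. {(u, x, y, v) \<in> space Q. u = a} = {w \<in> space Q. U w = a}"
    by (auto simp: U_def V_def)
  ultimately show ?thesis by (simp add: guessing_gain_def m_def F_def)
qed

section \<open>Approximation by an algebra\<close>

text \<open>The sets approximable to every precision form a sigma-algebra containing
  \<open>\<A>\<close>: complements have the same symmetric difference, errors add under unions, and
  finitely many members almost exhaust a countable union. One \<open>A\<close> serves both measures
  because the applications compare its values under the two.\<close>

lemma finite_measures_approx_algebra:
  assumes M: "finite_measure M" and N: "finite_measure N"
    and setsM: "sets M = sigma_sets \<Omega> \<A>" and setsN: "sets N = sigma_sets \<Omega> \<A>"
    and alg: "algebra \<Omega> \<A>"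
    and B: "B \<in> sigma_sets \<Omega> \<A>" and e: "e > 0"
  shows "\<exists>A\<in>\<A>. measure M (sym_diff A B) < e \<and> measure N (sym_diff A B) < e"
proof -
  interpret M: finite_measure M by fact
  interpret N: finite_measure N by fact
  interpret algebra \<Omega> \<A> by fact
  have spM: "space M = \<Omega>" and spN: "space N = \<Omega>"
    using sets_eq_imp_space_eq[of M "sigma \<Omega> \<A>"] sets_eq_imp_space_eq[of N "sigma \<Omega> \<A>"]
      space_closed by (simp_all add: setsM setsN)
  have setsNM: "sets N = sets M" by (simp add: setsM setsN)
  have inM: "A \<in> \<A> \<Longrightarrow> A \<in> sets M" for A by (simp add: setsM)
  define near where "near B e A \<longleftrightarrow> measure M (sym_diff A B) < e \<and> measure N (sym_diff A B) < e" for B A e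
  have near_Un: "near (B \<union> B') (e + e') (A \<union> A')"
    if "near B e A" "near B' e' A'" "A \<in> sets M" "A' \<in> sets M" "B \<in> sets M" "B' \<in> sets M"
    for A A' B B' e e'
  proof -
    have [measurable]: "sym_diff A B \<in> sets M" "sym_diff A' B' \<in> sets M" using that by auto
    have sub: "sym_diff (A \<union> A') (B \<union> B') \<subseteq> sym_diff A B \<union> sym_diff A' B'" by auto
    have "measure M (sym_diff (A \<union> A') (B \<union> B')) \<le> measure M (sym_diff A B) + measure M (sym_diff A' B')"
      by (rule order_trans[OF M.finite_measure_mono[OF sub] measure_Un_le]) auto
    moreover have "measure N (sym_diff (A \<union> A') (B \<union> B')) \<le> measure N (sym_diff A B) + measure N (sym_diff A' B')"
      by (rule order_trans[OF N.finite_measure_mono[OF sub] measure_Un_le]) (auto simp: setsNM)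
    ultimately show ?thesis using that by (simp add: near_def)
  qed
  have "\<forall>e>0. \<exists>A\<in>\<A>. near B e A" using B
  proof induction
    case (Basic a)
    then show ?case by (auto simp: near_def intro!: bexI[of _ a])
  next
    case Empty
    then show ?case by (auto simp: near_def intro!: bexI[of _ "{}"])
  next
    case (Compl a)
    have "sym_diff (\<Omega> - A) (\<Omega> - a) = sym_diff A a" if "A \<in> \<A>" for A
      using sigma_sets_into_sp[OF space_closed Compl.hyps] space_closed that by blast
    then show ?case
      using Compl.IH by (auto simp: near_def) (metis compl_sets)
  next
    case (Union a)
    have aM: "a i \<in> sets M" for i using Union.hyps by (simp add: setsM)
    have fin: "\<forall>e>0. \<exists>A\<in>\<A>. near (\<Union>i<n. a i) e A" for n
    proof (induction n)
      case 0
      then show ?case by (auto simp: near_def intro!: bexI[of _ "{}"])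
    next
      case (Suc n)
      show ?case
      proof (intro allI impI)
        fix e :: real assume "e > 0"
        then obtain A A' where A: "A \<in> \<A>" "near (\<Union>i<n. a i) (e/2) A" "A' \<in> \<A>" "near (a n) (e/2) A'"
          using Suc Union.IH by (meson half_gt_zero)
        have "near ((\<Union>i<n. a i) \<union> a n) (e/2 + e/2) (A \<union> A')"
          using A aM by (intro near_Un) (auto intro: inM)
        then show "\<exists>A\<in>\<A>. near (\<Union>i<Suc n. a i) e A"
          using A by (intro bexI[of _ "A \<union> A'"]) (auto simp: lessThan_Suc Un_commute)
      qed
    qed
    let ?U = "\<Union>i. a i"
    \<comment> \<open>What the first \<open>n\<close> sets miss decreases to the empty set, so its
      finite measure tends to \<open>0\<close>.\<close>
    have lim: "(\<lambda>n. measure L (?U - (\<Union>i<n. a i))) \<longlonglongrightarrow> 0"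
      if L: "finite_measure L" "sets L = sets M" for L
    proof -
      interpret L: finite_measure L by fact
      have "(\<lambda>n. measure L (?U - (\<Union>i<n. a i))) \<longlonglongrightarrow> measure L (\<Inter>n. ?U - (\<Union>i<n. a i))"
        using aM L by (intro L.finite_Lim_measure_decseq) (force simp: decseq_def)+
      also have "(\<Inter>n. ?U - (\<Union>i<n. a i)) = {}" by auto
      finally show ?thesis by simp
    qed
    show ?case
    proof (intro allI impI)
      fix e :: real assume e: "e > 0"
      have "eventually (\<lambda>n. measure M (?U - (\<Union>i<n. a i)) < e/2 \<and> measure N (?U - (\<Union>i<n. a i)) < e/2) sequentially"
        using e lim[OF M refl] lim[OF N setsNM]
        by (intro eventually_conj order_tendstoD(2)[where y=0]) auto
      then obtain n where n: "measure M (?U - (\<Union>i<n. a i)) < e/2" "measure N (?U - (\<Union>i<n. a i)) < e/2"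
        by (auto simp: eventually_sequentially)
      from fin[of n] e obtain A where A: "A \<in> \<A>" "near (\<Union>i<n. a i) (e/2) A" by (meson half_gt_zero)
      \<comment> \<open>The remainder is approximated by the empty set, and the two errors
        \<open>e/2\<close> add up to \<open>e\<close>.\<close>
      let ?R = "?U - (\<Union>i<n. a i)"
      have "near ?R (e/2) {}" using n by (simp add: near_def)
      then have "near ((\<Union>i<n. a i) \<union> ?R) (e/2 + e/2) (A \<union> {})"
        using A aM by (intro near_Un) (auto intro: inM)
      moreover have "(\<Union>i<n. a i) \<union> ?R = ?U" by auto
      ultimately show "\<exists>A\<in>\<A>. near ?U e A" using A by auto
    qed
  qed
  then show ?thesis using e by (simp add: near_def)
qed

lemma (in finite_measure) measure_le_sym_diff:
  assumes "A \<in> sets M" "B \<in> sets M"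
  shows "measure M A \<le> measure M B + measure M (sym_diff A B)"
  using assms by (intro order_trans[OF finite_measure_mono measure_Un_le]) auto

text \<open>Starting from \<open>G\<close>, each stage adds complements and pairwise unions and so
  stays countable. The union of all stages is closed under unions because any two of its sets lie in
  a common stage.\<close>

lemma countable_algebra_superset:
  assumes G: "countable G" "G \<subseteq> Pow \<Omega>"
  obtains \<A> where "countable \<A>" "G \<subseteq> \<A>" "algebra \<Omega> \<A>" "sigma_sets \<Omega> \<A> = sigma_sets \<Omega> G"
proof -
  define H where "H = rec_nat (insert {} G) (\<lambda>_ \<B>. \<B> \<union> (\<lambda>a. \<Omega> - a) ` \<B> \<union> (\<lambda>(a, b). a \<union> b) ` (\<B> \<times> \<B>))"
  have H0: "H 0 = insert {} G"
    and HS: "H (Suc n) = H n \<union> (\<lambda>a. \<Omega> - a) ` H n \<union> (\<lambda>(a, b). a \<union> b) ` (H n \<times> H n)" for n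
    by (simp_all add: H_def)
  have mono: "H m \<subseteq> H n" if "m \<le> n" for m n
    by (rule lift_Suc_mono_le[OF _ that]) (auto simp: HS)
  have cnt: "countable (H n)" for n by (induction n) (auto simp: H0 HS G)
  have sub: "H n \<subseteq> sigma_sets \<Omega> G" for n
  proof (induction n)
    case 0
    then show ?case by (auto simp: H0 intro: sigma_sets.intros)
  next
    case (Suc n)
    then show ?case by (auto simp: HS intro!: sigma_sets.Compl sigma_sets_Un)
  qed
  let ?A = "\<Union>n. H n"
  show thesis
  proof (rule that[of ?A])
    show "countable ?A" using cnt by auto
    show "G \<subseteq> ?A" using H0 by auto
    show "algebra \<Omega> ?A"
      unfolding algebra_iff_Un
    proof (intro conjI ballI)
      show "?A \<subseteq> Pow \<Omega>" using sub sigma_sets_into_sp[OF G(2)] by blast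
      show "{} \<in> ?A" using H0 by auto
    next
      fix a assume "a \<in> ?A"
      then show "\<Omega> - a \<in> ?A" using HS by blast
    next
      fix a b assume "a \<in> ?A" "b \<in> ?A"
      then obtain m n where "a \<in> H m" "b \<in> H n" by auto
      then have "a \<in> H (max m n)" "b \<in> H (max m n)"
        using mono[of m "max m n"] mono[of n "max m n"] by auto
      then have "a \<union> b \<in> H (Suc (max m n))" unfolding HS by force
      then show "a \<union> b \<in> ?A" by blast
    qed
    show "sigma_sets \<Omega> ?A = sigma_sets \<Omega> G"
    proof
      show "sigma_sets \<Omega> ?A \<subseteq> sigma_sets \<Omega> G"
        using sub by (intro sigma_sets_mono) auto
      show "sigma_sets \<Omega> G \<subseteq> sigma_sets \<Omega> ?A"
        using \<open>G \<subseteq> ?A\<close> by (intro sigma_sets_mono) auto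
    qed
  qed
qed

text \<open>Approximation under both \<open>M\<close> and the measure with density \<open>f\<close>
  extends the inequality from \<open>\<A>\<close> to all measurable sets. On
  \<open>{x. c < f x}\<close> it contradicts the strict inequality unless that set is null.\<close>

lemma (in finite_measure) esssup_le_of_algebra:
  fixes f :: "'a \<Rightarrow> ennreal"
  assumes [measurable]: "f \<in> borel_measurable M" and fin: "(\<integral>\<^sup>+x. f x \<partial>M) \<noteq> \<infinity>"
    and sets: "sets M = sigma_sets \<Omega> \<A>" and alg: "algebra \<Omega> \<A>"
    and le: "\<And>A. A \<in> \<A> \<Longrightarrow> (\<integral>\<^sup>+x\<in>A. f x \<partial>M) \<le> c * emeasure M A"
  shows "esssup M f \<le> c"
proof (cases c)
  case (real r)
  let ?N = "density M f"
  interpret N: finite_measure ?N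
    using fin by (intro finite_measureI) (simp add: emeasure_density)
  have le': "measure ?N A \<le> r * measure M A" if A: "A \<in> sets M" for A
  proof (rule field_le_epsilon)
    fix e :: real assume e: "e > 0"
    \<comment> \<open>Passing between \<open>A\<close> and \<open>A'\<close> costs \<open>d\<close>
      under \<open>?N\<close> and \<open>d\<close> under \<open>M\<close>, the latter multiplied by
      \<open>r\<close>; hence \<open>(1 + r) * d = e\<close>.\<close>
    define d where "d = e / (1 + r)"
    have d: "d > 0" using e real by (simp add: d_def)
    obtain A' where A': "A' \<in> \<A>" "measure M (sym_diff A' A) < d" "measure ?N (sym_diff A' A) < d"
      using finite_measures_approx_algebra[OF finite_measure_axioms N.finite_measure_axioms sets _ alg _ d, of A]
        A sets by auto
    have A'M: "A' \<in> sets M" using A' sets by auto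
    have "ennreal (measure ?N A') \<le> ennreal (r * measure M A')"
      using le[OF A'(1)] A'M real
      by (simp add: N.emeasure_eq_measure[symmetric] emeasure_eq_measure ennreal_mult emeasure_density)
    then have "measure ?N A' \<le> r * measure M A'" using real by simp
    moreover have "measure ?N A \<le> measure ?N A' + measure ?N (sym_diff A' A)"
      using N.measure_le_sym_diff[of A A'] that A'M by (simp add: Un_commute)
    moreover have "measure M A' \<le> measure M A + measure M (sym_diff A' A)"
      using measure_le_sym_diff[of A' A] that A'M by simp
    then have "r * measure M A' \<le> r * measure M A + r * d"
      using A'(2) real by (simp flip: distrib_left add: mult_left_mono)
    ultimately have "measure ?N A \<le> r * measure M A + (1 + r) * d"
      using A'(3) by (simp add: algebra_simps)
    then show "measure ?N A \<le> r * measure M A + e"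
      using real by (simp add: d_def)
  qed
  show ?thesis
  proof (rule esssup_I)
    have [measurable]: "{x \<in> space M. c < f x} \<in> sets M" by measurable
    show "AE x in M. f x \<le> c"
    proof (rule ccontr)
      let ?B = "{x \<in> space M. c < f x}"
      assume "\<not> (AE x in M. f x \<le> c)"
      then have "\<not> (AE x in M. x \<notin> ?B)"
        by (auto elim!: contrapos_nn simp: not_less elim: AE_mp)
      have "(\<integral>\<^sup>+x\<in>?B. c \<partial>M) < (\<integral>\<^sup>+x\<in>?B. f x \<partial>M)"
      proof (rule nn_integral_less)
        show "(\<integral>\<^sup>+x\<in>?B. c \<partial>M) \<noteq> \<infinity>"
          using real by (simp add: nn_integral_cmult_indicator ennreal_mult_eq_top_iff)
        show "AE x in M. c * indicator ?B x \<le> f x * indicator ?B x"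
          by (auto simp: indicator_def)
        show "\<not> (AE x in M. f x * indicator ?B x \<le> c * indicator ?B x)"
        proof
          assume "AE x in M. f x * indicator ?B x \<le> c * indicator ?B x"
          then have "AE x in M. x \<notin> ?B" by eventually_elim (auto simp: indicator_def)
          with \<open>\<not> (AE x in M. x \<notin> ?B)\<close> show False by simp
        qed
      qed auto
      also have "\<dots> = emeasure ?N ?B" by (simp add: emeasure_density)
      also have "\<dots> \<le> ennreal (r * measure M ?B)"
        using le'[of ?B] by (simp add: N.emeasure_eq_measure ennreal_leI)
      also have "\<dots> = c * emeasure M ?B"
        using real by (simp add: ennreal_mult emeasure_eq_measure)
      also have "\<dots> = (\<integral>\<^sup>+x\<in>?B. c \<partial>M)" by (simp add: nn_integral_cmult_indicator)
      finally show False by simp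
    qed
  qed simp
qed (simp add: top_unique)

section \<open>Construction of guessing laws\<close>

text \<open>The construction makes the success probability \<open>\<epsilon>\<close> times the
  integral while no letter has probability above \<open>\<epsilon>\<close>, so
  \<open>\<epsilon>\<close> drops out of the gain.\<close>

lemma maximal_leakage_ge:
  fixes w :: "nat \<Rightarrow> 'x \<Rightarrow> real" and MX :: "'x measure" and MY :: "'y measure"
  assumes pXY: "prob_space PXY" and setsXY[measurable_cong]: "sets PXY = sets (MX \<Otimes>\<^sub>M MY)"
    and k[measurable]: "k \<in> measurable MY (count_space {..<n})"
    and w[measurable]: "\<And>i. w i \<in> borel_measurable MX"
    and w_bounds: "\<And>i x. 0 \<le> w i x" "\<And>i x. w i x \<le> C i"
    and w_int: "\<And>i. (\<integral>\<^sup>+x. w i x \<partial>distr PXY MX fst) \<le> 1"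
  shows "ln_ext (\<integral>\<^sup>+z. w (k (snd z)) (fst z) \<partial>PXY) \<le> maximal_leakage MX MY PXY"
proof -
  interpret PXY: prob_space PXY by fact
  have kn: "y \<in> space MY \<Longrightarrow> k y < n" for y using measurable_space[OF k] by simp
  have spXY: "space PXY = space MX \<times> space MY"
    using sets_eq_imp_space_eq[OF setsXY] by (simp add: space_pair_measure)
  have n: "n > 0" using PXY.not_empty kn by (auto simp: spXY)
  \<comment> \<open>A common bound of the \<open>w i\<close> with \<open>i < n\<close>; the summand
    \<open>1\<close> keeps it positive.\<close>
  define C' where "C' = 1 + (\<Sum>i<n. \<bar>C i\<bar>)"
  have C': "C' \<ge> 1" by (simp add: C'_def sum_nonneg)
  have wC': "w i x \<le> C'" if "i < n" for i x
    using w_bounds(2)[of i x] member_le_sum[of i "{..<n}" "\<lambda>i. \<bar>C i\<bar>"] that by (simp add: C'_def)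
  \<comment> \<open>Small enough that the \<open>n\<close> weights \<open>\<epsilon> * w i x\<close>
    add up to at most \<open>1\<close>.\<close>
  define \<epsilon> where "\<epsilon> = 1 / (real n * C')"
  have \<epsilon>: "\<epsilon> > 0" using n C' by (simp add: \<epsilon>_def)
  \<comment> \<open>Enough extra letters that an equal share of the leftover mass is at most
    \<open>\<epsilon>\<close>.\<close>
  obtain m :: nat where m: "1 / \<epsilon> < real m" using reals_Archimedean2 by blast
  have m0: "m > 0" using \<epsilon> m by (metis gr0I of_nat_0 not_less_iff_gr_or_eq order_less_trans zero_less_divide_1_iff)
  have m\<epsilon>: "1 / real m \<le> \<epsilon>" using m \<epsilon> m0 by (simp add: field_simps)
  \<comment> \<open>The conditional law of \<open>U\<close> given \<open>X = x\<close>; the letters \<open>n, ..., n + m - 1\<close> share the mass left over.\<close>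
  define h where "h u x = (if u < n then \<epsilon> * w u x else (1 - (\<Sum>i<n. \<epsilon> * w i x)) / real m)" for u x
  have hm[measurable]: "h u \<in> borel_measurable MX" for u unfolding h_def[abs_def] by measurable
  have sum_le: "(\<Sum>i<n. \<epsilon> * w i x) \<le> 1" for x
  proof -
    have "(\<Sum>i<n. \<epsilon> * w i x) \<le> (\<Sum>i<n. \<epsilon> * C')"
      using \<epsilon> wC' by (intro sum_mono mult_left_mono) auto
    also have "\<dots> = 1" using n C' by (simp add: \<epsilon>_def)
    finally show ?thesis .
  qed
  have w_sum_nonneg: "0 \<le> (\<Sum>i<n. \<epsilon> * w i x)" for x
    using \<epsilon> w_bounds by (intro sum_nonneg) auto
  have h0: "0 \<le> h u x" for u x
    using \<epsilon> w_bounds sum_le by (auto simp: h_def)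
  define A where "A = {..<n + m}"
  have A: "finite A" "A \<noteq> {}" using n by (auto simp: A_def)
  have sum_h: "(\<Sum>u\<in>A. h u x) = 1" for x
  proof -
    have "(\<Sum>u\<in>A. h u x) = (\<Sum>u<n. h u x) + (\<Sum>u=n..<n+m. h u x)"
      unfolding A_def lessThan_atLeast0 by (rule sum.atLeastLessThan_concat[symmetric]) auto
    also have "\<dots> = (\<Sum>u<n. \<epsilon> * w u x) + (\<Sum>u=n..<n+m. (1 - (\<Sum>i<n. \<epsilon> * w i x)) / real m)"
      by (intro arg_cong2[where f="(+)"] sum.cong) (auto simp: h_def)
    finally show ?thesis using m0 by simp
  qed
  have sum_hS: "(\<Sum>u\<in>S. h u x) \<le> 1" if "S \<subseteq> A" for S x
    using sum_mono2[OF A(1) that, of "\<lambda>u. h u x"] h0 sum_h by simp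
  let ?QS = "count_space A \<Otimes>\<^sub>M MX \<Otimes>\<^sub>M MY \<Otimes>\<^sub>M count_space A"
  let ?R = "count_space A \<Otimes>\<^sub>M PXY"
  have kA[measurable]: "k \<in> measurable MY (count_space A)"
    by (rule measurable_compose[OF k, of "\<lambda>i. i"]) (auto simp: A_def)
  have kA': "y \<in> space MY \<Longrightarrow> k y \<in> A" for y using kn[of y] by (simp add: A_def)
  \<comment> \<open>\<open>(U, X, Y)\<close> has density \<open>h\<close> against counting measure
    times \<open>PXY\<close>, so \<open>U\<close> depends on \<open>(X, Y)\<close> through
    \<open>X\<close> only; \<open>V\<close> is set to \<open>k\<close> of \<open>Y\<close>.\<close>
  define Q where "Q = distr (density ?R (\<lambda>z. ennreal (h (fst z) (fst (snd z))))) ?QS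
    (\<lambda>z. (fst z, fst (snd z), snd (snd z), k (snd (snd z))))"
  interpret CA: sigma_finite_measure "count_space A" by (rule sigma_finite_measure_count_space_finite[OF A(1)])
  interpret R: pair_sigma_finite "count_space A" PXY ..
  have hR[measurable]: "(\<lambda>z. h (fst z) (fst (snd z))) \<in> borel_measurable ?R"
    by (rule measurable_pair_measure_countable1) (auto simp: countable_finite[OF A(1)])
  \<comment> \<open>Summing out \<open>U\<close> reduces integrals under \<open>Q\<close> to
    integrals under \<open>PXY\<close>.\<close>
  have QI: "(\<integral>\<^sup>+q. \<phi> q \<partial>Q) = (\<integral>\<^sup>+z. (\<Sum>u\<in>A. ennreal (h u (fst z)) * \<phi> (u, fst z, snd z, k (snd z))) \<partial>PXY)"
    if [measurable]: "\<phi> \<in> borel_measurable ?QS" for \<phi>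
  proof -
    have "(\<integral>\<^sup>+q. \<phi> q \<partial>Q) = (\<integral>\<^sup>+z. ennreal (h (fst z) (fst (snd z))) * \<phi> (fst z, fst (snd z), snd (snd z), k (snd (snd z))) \<partial>?R)"
      unfolding Q_def by (simp add: nn_integral_distr nn_integral_density)
    also have "\<dots> = (\<integral>\<^sup>+z. \<integral>\<^sup>+u. ennreal (h u (fst z)) * \<phi> (u, fst z, snd z, k (snd z)) \<partial>count_space A \<partial>PXY)"
      by (subst R.nn_integral_snd[symmetric]) auto
    finally show ?thesis by (simp add: nn_integral_count_space_finite[OF A(1)])
  qed
  have sQ[measurable_cong]: "sets Q = sets ?QS" by (simp add: Q_def)
  have spQ: "space Q = A \<times> space MX \<times> space MY \<times> A" by (simp add: Q_def space_pair_measure)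
  have emQ: "emeasure Q X = (\<integral>\<^sup>+z. (\<Sum>u\<in>A. ennreal (h u (fst z)) * indicator X (u, fst z, snd z, k (snd z))) \<partial>PXY)"
    if "X \<in> sets ?QS" for X
    using that QI[of "indicator X"] by (simp add: sQ)
  have pQ: "prob_space Q"
  proof
    have "emeasure Q (space Q) = (\<integral>\<^sup>+z. (\<Sum>u\<in>A. ennreal (h u (fst z))) \<partial>PXY)"
      using sets.top[of Q] unfolding sQ
      by (subst emQ) (auto simp: spXY spQ kA' intro!: nn_integral_cong sum.cong)
    also have "\<dots> = 1" by (simp add: sum_ennreal h0 sum_h PXY.emeasure_space_1)
    finally show "emeasure Q (space Q) = 1" .
  qed
  interpret Q: prob_space Q by fact
  define U X Y V where "U = (\<lambda>(u::nat, x::'x, y::'y, v::nat). u)" and "X = (\<lambda>(u::nat, x::'x, y::'y, v::nat). x)"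
    and "Y = (\<lambda>(u::nat, x::'x, y::'y, v::nat). y)" and "V = (\<lambda>(u::nat, x::'x, y::'y, v::nat). v)"
  note proj = U_def X_def Y_def V_def
  have [measurable]: "U \<in> measurable ?QS (count_space A)" "X \<in> measurable ?QS MX"
    "Y \<in> measurable ?QS MY" "V \<in> measurable ?QS (count_space A)"
    unfolding proj by measurable
  have dQ: "distr Q (MX \<Otimes>\<^sub>M MY) (\<lambda>q. (X q, Y q)) = PXY"
  proof (rule measure_eqI)
    fix B assume "B \<in> sets (distr Q (MX \<Otimes>\<^sub>M MY) (\<lambda>q. (X q, Y q)))"
    then have B[measurable]: "B \<in> sets (MX \<Otimes>\<^sub>M MY)" by simp
    have "emeasure (distr Q (MX \<Otimes>\<^sub>M MY) (\<lambda>q. (X q, Y q))) B = (\<integral>\<^sup>+q. indicator B (X q, Y q) \<partial>Q)"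
      using nn_integral_distr[of "\<lambda>q. (X q, Y q)" Q "MX \<Otimes>\<^sub>M MY" "indicator B"] by simp
    also have "\<dots> = (\<integral>\<^sup>+z. (\<Sum>u\<in>A. ennreal (h u (fst z))) * indicator B z \<partial>PXY)"
      by (subst QI) (auto simp: proj sum_distrib_right)
    also have "\<dots> = emeasure PXY B" by (simp add: sum_ennreal h0 sum_h setsXY)
    finally show "emeasure (distr Q (MX \<Otimes>\<^sub>M MY) (\<lambda>q. (X q, Y q))) B = emeasure PXY B" .
  qed (simp add: setsXY)
  \<comment> \<open>Integrands need only agree after averaging over \<open>U\<close> with the
    weights \<open>h\<close>, at each value of \<open>(X, Y)\<close>.\<close>
  have int_eq: "(\<integral>q. f q \<partial>Q) = (\<integral>q. g q \<partial>Q)"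
    if [measurable]: "f \<in> borel_measurable ?QS" "g \<in> borel_measurable ?QS"
      and "\<And>q. 0 \<le> f q" "\<And>q. 0 \<le> g q" 
      and eq: "\<And>z. (\<Sum>u\<in>A. h u (fst z) * f (u, fst z, snd z, k (snd z)))
        = (\<Sum>u\<in>A. h u (fst z) * g (u, fst z, snd z, k (snd z)))" for f g :: "_ \<Rightarrow> real"
    using that by (simp add: integral_eq_nn_integral QI sum_ennreal h0 ennreal_mult[symmetric])
  \<comment> \<open>The kernel of \<open>U\<close> given \<open>X\<close> is
    \<open>\<Sum>u\<in>S. h u x\<close>.\<close>
  have mc1: "markov_chain3 Q (count_space A) U MX X (MY \<Otimes>\<^sub>M count_space A) (\<lambda>q. (Y q, V q))"
  proof (rule Q.markov_chain3I)
    fix S assume "S \<in> sets (count_space A)"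
    then have S[measurable]: "S \<in> sets (count_space A)" and SA: "S \<subseteq> A" by auto
    have [simp]: "A \<inter> S = S" using SA by auto
    have "(\<integral>q. indicator S (U q) * (indicator E (X q) * indicator T (Y q, V q)) \<partial>Q)
      = (\<integral>q. (\<Sum>u\<in>S. h u (X q)) * (indicator E (X q) * indicator T (Y q, V q)) \<partial>Q)"
      if [measurable]: "E \<in> sets MX" "T \<in> sets (MY \<Otimes>\<^sub>M count_space A)" for E T
    proof (rule int_eq)
      fix z :: "'x \<times> 'y"
      let ?c = "indicator E (fst z) * indicator T (snd z, k (snd z)) :: real"
      have "(\<Sum>u\<in>A. h u (fst z) * (indicator S u * ?c)) = (\<Sum>u\<in>A. h u (fst z) * indicator S u) * ?c"
        by (subst sum_distrib_right) (simp add: mult_ac)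
      also have "\<dots> = (\<Sum>u\<in>S. h u (fst z)) * ?c"
        using A by (simp add: sum.inter_restrict[symmetric] indicator_def of_bool_def if_distrib[of "\<lambda>t. _ * t"] cong: if_cong)
      also have "\<dots> = (\<Sum>u\<in>A. h u (fst z)) * ((\<Sum>u\<in>S. h u (fst z)) * ?c)" by (simp add: sum_h)
      also have "\<dots> = (\<Sum>u\<in>A. h u (fst z) * ((\<Sum>u\<in>S. h u (fst z)) * ?c))" by (rule sum_distrib_right)
      finally show "(\<Sum>u\<in>A. h u (fst z) * (indicator S (U (u, fst z, snd z, k (snd z))) * (indicator E (X (u, fst z, snd z, k (snd z)))
          * indicator T (Y (u, fst z, snd z, k (snd z)), V (u, fst z, snd z, k (snd z))))))
        = (\<Sum>u\<in>A. h u (fst z) * ((\<Sum>u'\<in>S. h u' (X (u, fst z, snd z, k (snd z)))) * (indicator E (X (u, fst z, snd z, k (snd z)))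
          * indicator T (Y (u, fst z, snd z, k (snd z)), V (u, fst z, snd z, k (snd z))))))"
        by (simp add: proj)
    qed (auto intro!: mult_nonneg_nonneg sum_nonneg h0)
    then show "\<exists>h'\<in>borel_measurable MX. (\<forall>x\<in>space MX. \<bar>h' x\<bar> \<le> (1::real)) \<and>
      (\<forall>E\<in>sets MX. \<forall>T\<in>sets (MY \<Otimes>\<^sub>M count_space A).
        (\<integral>q. indicator S (U q) * (indicator E (X q) * indicator T (Y q, V q)) \<partial>Q)
        = (\<integral>q. h' (X q) * (indicator E (X q) * indicator T (Y q, V q)) \<partial>Q))"
      using sum_hS[OF SA] sum_nonneg[of S "\<lambda>u. h u _", OF h0]
      by (intro bexI[of _ "\<lambda>x. \<Sum>u\<in>S. h u x"]) auto
  qed measurable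
  \<comment> \<open>The chain is read backwards: \<open>V\<close> is determined by \<open>Y\<close>,
    so its kernel is the indicator of \<open>k y \<in> S\<close>.\<close>
  have mc2: "markov_chain3 Q (count_space A) V MY Y (count_space A \<Otimes>\<^sub>M MX) (\<lambda>q. (U q, X q))"
  proof (rule Q.markov_chain3I)
    fix S assume S[measurable]: "S \<in> sets (count_space A)"
    have "(\<integral>q. indicator S (V q) * (indicator E (Y q) * indicator T (U q, X q)) \<partial>Q)
      = (\<integral>q. indicator S (k (Y q)) * (indicator E (Y q) * indicator T (U q, X q) :: real) \<partial>Q)"
      if [measurable]: "E \<in> sets MY" "T \<in> sets (count_space A \<Otimes>\<^sub>M MX)" for E T
      by (rule int_eq) (auto simp: proj)
    then show "\<exists>h'\<in>borel_measurable MY. (\<forall>x\<in>space MY. \<bar>h' x\<bar> \<le> (1::real)) \<and>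
      (\<forall>E\<in>sets MY. \<forall>T\<in>sets (count_space A \<Otimes>\<^sub>M MX).
        (\<integral>q. indicator S (V q) * (indicator E (Y q) * indicator T (U q, X q)) \<partial>Q)
        = (\<integral>q. h' (Y q) * (indicator E (Y q) * indicator T (U q, X q)) \<partial>Q))"
      by (intro bexI[of _ "\<lambda>y. indicator S (k y)"]) (auto simp: indicator_def)
  qed measurable
  have law: "Q \<in> guessing_laws MX MY PXY A"
    using pQ sQ dQ mc1 markov_chain3_sym[OF mc2]
    by (auto simp: guessing_laws_def markov_chain4_def proj split_beta')
  have sets_U: "{q \<in> space Q. U q = a} \<in> sets ?QS" for a
  proof -
    have "U -` ({a} \<inter> A) \<inter> space ?QS \<in> sets ?QS"
      by (rule measurable_sets[where A="count_space A"]) auto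
    also have "U -` ({a} \<inter> A) \<inter> space ?QS = {q \<in> space Q. U q = a}"
      by (auto simp: spQ space_pair_measure U_def)
    finally show ?thesis .
  qed
  have PU: "measure Q {q \<in> space Q. U q = a} \<le> \<epsilon>" if a: "a \<in> A" for a
  proof -
    have "emeasure Q {q \<in> space Q. U q = a} = (\<integral>\<^sup>+z. ennreal (h a (fst z)) \<partial>PXY)"
    proof (subst emQ[OF sets_U], rule nn_integral_cong)
      fix z assume "z \<in> space PXY"
      then show "(\<Sum>u\<in>A. ennreal (h u (fst z)) * indicator {q \<in> space Q. U q = a} (u, fst z, snd z, k (snd z)))
        = ennreal (h a (fst z))"
        using A a kA' by (subst sum.remove[of _ a]) (auto simp: spQ spXY U_def indicator_def intro!: sum.neutral)
    qed
    also have "\<dots> \<le> ennreal \<epsilon>"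
    proof (cases "a < n")
      case True
      have "(\<integral>\<^sup>+z. ennreal (h a (fst z)) \<partial>PXY) = (\<integral>\<^sup>+z. ennreal \<epsilon> * ennreal (w a (fst z)) \<partial>PXY)"
        using True \<epsilon> w_bounds by (simp add: h_def ennreal_mult)
      also have "\<dots> = ennreal \<epsilon> * (\<integral>\<^sup>+x. w a x \<partial>distr PXY MX fst)"
        by (simp add: nn_integral_cmult nn_integral_distr)
      also have "\<dots> \<le> ennreal \<epsilon> * 1" by (intro mult_left_mono w_int) simp
      finally show ?thesis by simp
    next
      case False
      have "h a x \<le> \<epsilon>" for x
        using False m\<epsilon> m0 w_sum_nonneg[of x] by (auto simp: h_def divide_right_mono intro: order_trans[rotated])
      then have "(\<integral>\<^sup>+z. ennreal (h a (fst z)) \<partial>PXY) \<le> (\<integral>\<^sup>+z. ennreal \<epsilon> \<partial>PXY)"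
        by (intro nn_integral_mono ennreal_leI)
      then show ?thesis by (simp add: PXY.emeasure_space_1)
    qed
    finally show ?thesis using \<epsilon> by (simp add: Q.emeasure_eq_measure)
  qed
  define mx where "mx = Max ((\<lambda>a. measure Q {q \<in> space Q. U q = a}) ` A)"
  have mx_le: "mx \<le> \<epsilon>" unfolding mx_def using A PU by (intro Max.boundedI) auto
  have mx_ge: "measure Q {q \<in> space Q. U q = a} \<le> mx" if "a \<in> A" for a
    unfolding mx_def using A that by (intro Max_ge) auto
  \<comment> \<open>This excludes the default value of division by \<open>0\<close>. The letter
    probabilities cover total mass \<open>1\<close>, so they cannot all vanish.\<close>
  have mx_pos: "mx > 0"
  proof -
    have "1 = measure Q (\<Union>a\<in>A. {q \<in> space Q. U q = a})"
      unfolding Q.prob_space[symmetric] by (intro arg_cong2[where f=measure]) (auto simp: spQ U_def)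
    also have "\<dots> \<le> (\<Sum>a\<in>A. measure Q {q \<in> space Q. U q = a})"
      using A sets_U by (intro Q.finite_measure_subadditive_finite) (auto simp: sQ)
    also have "\<dots> \<le> (\<Sum>a\<in>A. mx)" by (intro sum_mono mx_ge)
    finally show ?thesis using A by (auto simp: zero_less_mult_iff dest: less_le_trans[OF zero_less_one])
  qed
  let ?I = "\<integral>\<^sup>+z. w (k (snd z)) (fst z) \<partial>PXY"
  have wk[measurable]: "(\<lambda>z. w (k (snd z)) (fst z)) \<in> borel_measurable PXY"
    by (rule measurable_compose_countable'[where I="{..<n}" and f="\<lambda>i z. w i (fst z)"]) auto
  have UV: "{q \<in> space Q. U q = V q} \<in> sets ?QS"
  proof -
    have "{q \<in> space Q. U q = V q} = (\<Union>a\<in>A. U -` {a} \<inter> space ?QS \<inter> (V -` {a} \<inter> space ?QS))"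
      by (auto simp: spQ space_pair_measure U_def V_def)
    also have "\<dots> \<in> sets ?QS"
      using A by (intro sets.finite_UN sets.Int measurable_sets[of U _ "count_space A"] measurable_sets[of V _ "count_space A"]) auto
    finally show ?thesis .
  qed
  have "emeasure Q {q \<in> space Q. U q = V q} = (\<integral>\<^sup>+z. ennreal \<epsilon> * ennreal (w (k (snd z)) (fst z)) \<partial>PXY)"
  proof (subst emQ[OF UV], rule nn_integral_cong)
    fix z assume z: "z \<in> space PXY"
    then have "k (snd z) < n" using kn by (auto simp: spXY)
    then show "(\<Sum>u\<in>A. ennreal (h u (fst z)) * indicator {q \<in> space Q. U q = V q} (u, fst z, snd z, k (snd z)))
        = ennreal \<epsilon> * ennreal (w (k (snd z)) (fst z))"
      using A z \<epsilon> w_bounds kA' by (subst sum.remove[of _ "k (snd z)"])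
        (auto simp: spQ spXY U_def V_def h_def ennreal_mult indicator_def intro!: sum.neutral)
  qed
  also have "\<dots> = ennreal \<epsilon> * ?I" by (intro nn_integral_cmult) simp
  finally have p: "ennreal (measure Q {q \<in> space Q. U q = V q}) = ennreal \<epsilon> * ?I"
    by (simp add: Q.emeasure_eq_measure)
  \<comment> \<open>The success probability equals \<open>\<epsilon> * ?I\<close> and
    \<open>mx \<le> \<epsilon>\<close>; being finite, it also excludes an infinite
    \<open>?I\<close>.\<close>
  have "?I \<le> ennreal (measure Q {q \<in> space Q. U q = V q} / mx)"
  proof (cases ?I)
    case (real r)
    with p \<epsilon> have "measure Q {q \<in> space Q. U q = V q} = \<epsilon> * r" by (simp flip: ennreal_mult)
    moreover have "mx * r \<le> \<epsilon> * r" using mx_le real by (intro mult_right_mono)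
    ultimately show ?thesis using real mx_pos by (auto simp: field_simps intro!: ennreal_leI)
  next
    case top
    with p \<epsilon> show ?thesis by (simp add: ennreal_mult_top)
  qed
  then have "ln_ext ?I \<le> ln_ext (ennreal (measure Q {q \<in> space Q. U q = V q} / mx))" by (rule ln_ext_mono)
  also have "\<dots> = guessing_gain A Q"
  proof -
    have "{(u, x, y, v) \<in> space Q. u = v} = {q \<in> space Q. U q = V q}"
      "\<And>a. {(u, x, y, v) \<in> space Q. u = a} = {q \<in> space Q. U q = a}" by (auto simp: U_def V_def)
    then show ?thesis by (simp add: guessing_gain_def mx_def)
  qed
  also have "\<dots> \<le> maximal_leakage MX MY PXY"
    unfolding maximal_leakage_def using A law by (intro Sup_upper) blast
  finally show ?thesis .
qed

section \<open>The lower bound\<close>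

lemma ln_ext_esssup_le_maximal_leakage:
  fixes MX PX :: "'x measure" and MY PY :: "'y measure"
  assumes pXY: "prob_space PXY" and setsXY[measurable_cong]: "sets PXY = sets (MX \<Otimes>\<^sub>M MY)"
    and PX: "PX = distr PXY MX fst" and PY: "PY = distr PXY MY snd"
    and f[measurable]: "f \<in> borel_measurable (PX \<Otimes>\<^sub>M PY)"
    and dens: "density (PX \<Otimes>\<^sub>M PY) f = PXY"
    and cg: "countably_generated MX"
  shows "ln_ext (\<integral>\<^sup>+ y. esssup PX (\<lambda>x. f (x, y)) \<partial>PY) \<le> maximal_leakage MX MY PXY"
proof -
  interpret PXY: prob_space PXY by fact
  have fst': "fst \<in> measurable PXY MX" and snd': "snd \<in> measurable PXY MY"
    using setsXY by (simp_all cong: measurable_cong_sets)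
  interpret PX: prob_space PX unfolding PX by (rule PXY.prob_space_distr[OF fst'])
  interpret PY: prob_space PY unfolding PY by (rule PXY.prob_space_distr[OF snd'])
  have sX[measurable_cong]: "sets PX = sets MX" and sY[measurable_cong]: "sets PY = sets MY"
    and spX: "space PX = space MX"
    by (simp_all add: PX PY)
  interpret PP: pair_sigma_finite PX PY ..
  obtain G where G: "countable G" "G \<subseteq> Pow (space MX)" "sets MX = sigma_sets (space MX) G"
    using cg by (auto simp: countably_generated_def)
  obtain \<A> where \<A>: "countable \<A>" "algebra (space MX) \<A>" "sets MX = sigma_sets (space MX) \<A>"
    using countable_algebra_superset[OF G(1,2)] G(3) by metis
  interpret \<A>: algebra "space MX" \<A> by fact
  \<comment> \<open>Averages make sense over sets of positive measure. The whole space is one of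
    them, so the enumeration \<open>A\<close> has exactly these sets as its values.\<close>
  define \<A>' where "\<A>' = {a \<in> \<A>. measure PX a > 0}"
  have "space MX \<in> \<A>'" using PX.prob_space by (simp add: \<A>'_def spX)
  moreover have "countable \<A>'" using \<A>(1) by (auto simp: \<A>'_def intro: countable_subset[of _ \<A>])
  ultimately have rngA: "range (from_nat_into \<A>') = \<A>'" by (intro range_from_nat_into) auto
  define A where "A = from_nat_into \<A>'"
  have A\<A>': "A i \<in> \<A>'" for i using rngA by (auto simp: A_def)
  have [measurable]: "A i \<in> sets MX" for i
    using A\<A>'[of i] by (simp add: \<A>'_def \<A>(3))
  have Apos: "measure PX (A i) > 0" for i using A\<A>'[of i] by (simp add: \<A>'_def)
  \<comment> \<open>Integrating a section of \<open>f\<close> against \<open>w i\<close> averages it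
    over \<open>A i\<close>, and \<open>w i\<close> itself has integral \<open>1\<close>.\<close>
  define w where "w i x = indicator (A i) x / measure PX (A i)" for i x
  have [measurable]: "w i \<in> borel_measurable MX" for i unfolding w_def[abs_def] by measurable
  define r where "r i y = (\<integral>\<^sup>+x. f (x, y) * ennreal (w i x) \<partial>PX)" for i y
  have r[measurable]: "r i \<in> borel_measurable MY" for i unfolding r_def[abs_def] by measurable
  \<comment> \<open>\<open>kk n y\<close> is an index \<open>i \<le> n\<close> maximising \<open>r i y\<close>.\<close>
  define kk where "kk = rec_nat (\<lambda>_. 0) (\<lambda>n k y. if r (k y) y < r (Suc n) y then Suc n else k y)"
  have kk0: "kk 0 y = 0" and kkS: "kk (Suc n) y = (if r (kk n y) y < r (Suc n) y then Suc n else kk n y)" for n y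
    by (simp_all add: kk_def)
  have kk_less: "kk n y < Suc n" for n y
    by (induction n) (auto simp: kk0 kkS intro: less_SucI)
  have kkM[measurable]: "kk n \<in> measurable MY (count_space UNIV)" for n
  proof (induction n)
    case 0
    then show ?case by (simp add: kk0[abs_def])
  next
    case (Suc n)
    note [measurable] = this
    have [measurable]: "(\<lambda>y. r (kk n y) y) \<in> borel_measurable MY"
      by (rule measurable_compose_countable[where f=r]) auto
    show ?case unfolding kkS[abs_def] by measurable
  qed
  define R where "R n y = r (kk n y) y" for n y
  have [measurable]: "R n \<in> borel_measurable MY" for n
    unfolding R_def by (rule measurable_compose_countable[where f=r]) auto
  have R_mono: "incseq R"
    by (rule incseq_SucI) (auto simp: R_def le_fun_def kkS)
  have R_ge: "r n y \<le> R n y" for n y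
    by (cases n) (auto simp: R_def kk0 kkS not_less)
  \<comment> \<open>Guessing the letter \<open>kk n y\<close> yields the integral of the largest of
    the first \<open>n + 1\<close> averages.\<close>
  have IR: "ln_ext (\<integral>\<^sup>+y. R n y \<partial>PY) \<le> maximal_leakage MX MY PXY" for n
  proof -
    have [measurable]: "(\<lambda>z. w (kk n (snd z)) (fst z)) \<in> borel_measurable (MX \<Otimes>\<^sub>M MY)"
      by (rule measurable_compose_countable[where f="\<lambda>i z. w i (fst z)"]) auto
    have "(\<integral>\<^sup>+z. w (kk n (snd z)) (fst z) \<partial>PXY) = (\<integral>\<^sup>+z. f z * ennreal (w (kk n (snd z)) (fst z)) \<partial>(PX \<Otimes>\<^sub>M PY))"
      unfolding dens[symmetric] by (simp add: nn_integral_density)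
    also have "\<dots> = (\<integral>\<^sup>+y. R n y \<partial>PY)"
      using PP.nn_integral_snd[of "\<lambda>z. f z * ennreal (w (kk n (snd z)) (fst z))"]
      by (simp add: R_def r_def)
    finally have "(\<integral>\<^sup>+y. R n y \<partial>PY) = (\<integral>\<^sup>+z. w (kk n (snd z)) (fst z) \<partial>PXY)" ..
    also have "ln_ext \<dots> \<le> maximal_leakage MX MY PXY"
    proof (rule maximal_leakage_ge[OF pXY setsXY, where k="kk n"])
      show "kk n \<in> measurable MY (count_space {..<Suc n})"
        using kk_less kkM by (subst measurable_count_space_eq2) (auto intro: measurable_sets[OF kkM])
      show "w i x \<le> 1 / measure PX (A i)" for i x
        using Apos[of i] by (auto simp: w_def indicator_def)
      show "(\<integral>\<^sup>+x. ennreal (w i x) \<partial>distr PXY MX fst) \<le> 1" for i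
      proof -
        have "(\<integral>\<^sup>+x. ennreal (w i x) \<partial>PX) = (\<integral>\<^sup>+x. ennreal (1 / measure PX (A i)) * indicator (A i) x \<partial>PX)"
          by (intro nn_integral_cong) (auto simp: w_def indicator_def)
        also have "\<dots> = 1"
          using Apos[of i] by (simp add: nn_integral_cmult_indicator PX.emeasure_eq_measure flip: ennreal_mult)
        finally show ?thesis by (simp add: PX)
      qed
    qed (auto simp: w_def)
    finally show ?thesis .
  qed
  have "(\<integral>\<^sup>+y. \<integral>\<^sup>+x. f (x, y) \<partial>PX \<partial>PY) = emeasure PXY (space PXY)"
    unfolding dens[symmetric]
    by (subst PP.nn_integral_snd) (auto simp: emeasure_density intro!: nn_integral_cong)
  then have fin: "(\<integral>\<^sup>+y. \<integral>\<^sup>+x. f (x, y) \<partial>PX \<partial>PY) \<noteq> \<infinity>"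
    by (simp add: PXY.emeasure_space_1)
  \<comment> \<open>Almost every section has finite integral, as \<open>esssup_le_of_algebra\<close>
    demands.\<close>
  have "AE y in PY. (\<integral>\<^sup>+x. f (x, y) \<partial>PX) \<noteq> \<infinity>"
    using fin by (intro nn_integral_PInf_AE) auto
  then have "AE y in PY. esssup PX (\<lambda>x. f (x, y)) \<le> (SUP n. R n y)"
  proof (rule AE_mp, intro AE_I2 impI)
    fix y assume y[measurable]: "y \<in> space PY" and fin: "(\<integral>\<^sup>+x. f (x, y) \<partial>PX) \<noteq> \<infinity>"
    show "esssup PX (\<lambda>x. f (x, y)) \<le> (SUP n. R n y)"
    proof (rule PX.esssup_le_of_algebra[OF _ fin, of "space MX" \<A>])
      fix a assume a: "a \<in> \<A>"
      then have [measurable]: "a \<in> sets MX" by (simp add: \<A>(3))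
      show "(\<integral>\<^sup>+x\<in>a. f (x, y) \<partial>PX) \<le> (SUP n. R n y) * emeasure PX a"
      \<comment> \<open>A set of positive measure is some \<open>A i\<close>, with average
        \<open>r i y \<le> R i y\<close>; over a null set the integral vanishes.\<close>
      proof (cases "measure PX a > 0")
        case True
        then obtain i where i: "a = A i" using a rngA by (auto simp: \<A>'_def A_def set_eq_iff image_iff)
        have "(\<integral>\<^sup>+x\<in>a. f (x, y) \<partial>PX) = (\<integral>\<^sup>+x. f (x, y) * ennreal (w i x) * emeasure PX a \<partial>PX)"
          using Apos[of i] unfolding i
          by (intro nn_integral_cong)
             (auto simp: w_def indicator_def PX.emeasure_eq_measure mult.assoc simp flip: ennreal_mult)
        also have "\<dots> = r i y * emeasure PX a"
          unfolding r_def by (rule nn_integral_multc) simp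
        also have "\<dots> \<le> (SUP n. R n y) * emeasure PX a"
          using R_ge[of i y] by (intro mult_right_mono) (auto intro: SUP_upper2)
        finally show ?thesis .
      next
        case False
        then have "a \<in> null_sets PX"
          by (auto simp: null_sets_def PX.emeasure_eq_measure sX not_less measure_le_0_iff)
        then have "(\<integral>\<^sup>+x\<in>a. f (x, y) \<partial>PX) = 0" by (rule nn_integral_null_set)
        then show ?thesis by simp
      qed
    qed (use \<A> in \<open>auto simp: sX\<close>)
  qed
  then have "(\<integral>\<^sup>+ y. esssup PX (\<lambda>x. f (x, y)) \<partial>PY) \<le> (\<integral>\<^sup>+y. (SUP n. R n y) \<partial>PY)"
    by (rule nn_integral_mono_AE)
  also have "\<dots> = (SUP n. \<integral>\<^sup>+y. R n y \<partial>PY)"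
    using R_mono by (intro nn_integral_monotone_convergence_SUP) auto
  finally show ?thesis by (rule ln_ext_le_SUP[OF IR])
qed

section \<open>Failure of absolute continuity: sets with finitely many sections\<close>

text \<open>For a set-valued \<open>s\<close>, \<open>simple_function\<close> means finitely many
  values with measurable level sets. The members are the finite unions of measurable rectangles,
  presented so that their sections can be read off.\<close>

definition section_algebra :: "'x measure \<Rightarrow> 'y measure \<Rightarrow> ('x \<times> 'y) set set" where
  "section_algebra MX MY = (\<lambda>s. {(x, y). y \<in> space MY \<and> x \<in> s y}) `
     {s. simple_function MY s \<and> (\<forall>y\<in>space MY. s y \<in> sets MX)}"

lemma section_algebraI:
  assumes "simple_function MY s" "\<And>y. y \<in> space MY \<Longrightarrow> s y \<in> sets MX"
    "R = {(x, y). y \<in> space MY \<and> x \<in> s y}"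
  shows "R \<in> section_algebra MX MY"
  using assms by (auto simp: section_algebra_def)

text \<open>There is one rectangle for each of the finitely many values of \<open>s\<close>.\<close>

lemma section_algebra_measurable:
  assumes "R \<in> section_algebra MX MY"
  shows "R \<in> sets (MX \<Otimes>\<^sub>M MY)"
proof -
  obtain s where s: "simple_function MY s" "\<And>y. y \<in> space MY \<Longrightarrow> s y \<in> sets MX"
    and R: "R = {(x, y). y \<in> space MY \<and> x \<in> s y}"
    using assms by (auto simp: section_algebra_def)
  have "R = (\<Union>c\<in>s ` space MY. c \<times> (s -` {c} \<inter> space MY))" by (auto simp: R)
  also have "\<dots> \<in> sets (MX \<Otimes>\<^sub>M MY)"
    using s by (intro sets.finite_UN pair_measureI) (auto simp: simple_function_def)
  finally show ?thesis .
qed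

text \<open>Set operations act section by section, and a function of simple functions is
  simple.\<close>

lemma algebra_section_algebra: "algebra (space MX \<times> space MY) (section_algebra MX MY)"
  unfolding algebra_iff_Un
proof (intro conjI ballI)
  show "section_algebra MX MY \<subseteq> Pow (space MX \<times> space MY)"
    using sets.sets_into_space[OF section_algebra_measurable, of _ MX MY]
    by (auto simp: space_pair_measure)
  show "{} \<in> section_algebra MX MY" by (rule section_algebraI[of _ "\<lambda>_. {}"]) auto
next
  fix R assume "R \<in> section_algebra MX MY"
  then obtain s where s: "simple_function MY s" "\<And>y. y \<in> space MY \<Longrightarrow> s y \<in> sets MX"
    and R: "R = {(x, y). y \<in> space MY \<and> x \<in> s y}"
    by (auto simp: section_algebra_def)
  show "space MX \<times> space MY - R \<in> section_algebra MX MY"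
  proof (rule section_algebraI[of _ "\<lambda>y. space MX - s y"])
    show "simple_function MY (\<lambda>y. space MX - s y)" by (rule simple_function_compose1[OF s(1)])
  qed (use s in \<open>auto simp: R\<close>)
next
  fix R R' assume "R \<in> section_algebra MX MY" "R' \<in> section_algebra MX MY"
  then obtain s s' where s: "simple_function MY s" "\<And>y. y \<in> space MY \<Longrightarrow> s y \<in> sets MX"
    and R: "R = {(x, y). y \<in> space MY \<and> x \<in> s y}"
    and s': "simple_function MY s'" "\<And>y. y \<in> space MY \<Longrightarrow> s' y \<in> sets MX"
    and R': "R' = {(x, y). y \<in> space MY \<and> x \<in> s' y}"
    by (auto simp: section_algebra_def)
  show "R \<union> R' \<in> section_algebra MX MY"
  proof (rule section_algebraI[of _ "\<lambda>y. s y \<union> s' y"])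
    show "simple_function MY (\<lambda>y. s y \<union> s' y)" by (rule simple_function_compose2[OF s(1) s'(1)])
  qed (use s s' in \<open>auto simp: R R'\<close>)
qed

text \<open>A rectangle \<open>a \<times> b\<close> has no sections other than \<open>a\<close> and
  \<open>{}\<close>, so the algebra contains the generator of the product sigma-algebra.\<close>

lemma sets_pair_eq_section_algebra:
  "sets (MX \<Otimes>\<^sub>M MY) = sigma_sets (space MX \<times> space MY) (section_algebra MX MY)"
proof
  show "sigma_sets (space MX \<times> space MY) (section_algebra MX MY) \<subseteq> sets (MX \<Otimes>\<^sub>M MY)"
    using sets.sigma_sets_subset[of "section_algebra MX MY" "MX \<Otimes>\<^sub>M MY"] section_algebra_measurable
    by (auto simp: space_pair_measure)
  have "a \<times> b \<in> section_algebra MX MY" if "a \<in> sets MX" "b \<in> sets MY" for a b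
  proof (rule section_algebraI[of _ "\<lambda>y. if y \<in> b then a else {}"])
    have "{y \<in> space MY. y \<in> b} \<in> sets MY" using that by simp
    then show "simple_function MY (\<lambda>y. if y \<in> b then a else {})"
      by (intro simple_function_If) auto
  qed (use that sets.sets_into_space[OF that(2)] in auto)
  then show "sets (MX \<Otimes>\<^sub>M MY) \<subseteq> sigma_sets (space MX \<times> space MY) (section_algebra MX MY)"
    unfolding sets_pair_measure by (intro sigma_sets_mono) auto
qed

text \<open>If a product-null set has \<open>PXY\<close>-mass \<open>\<delta> > 0\<close>, the
  leakage is at least the logarithm of \<open>K * \<delta> / 2\<close> for every
  \<open>K > 0\<close>.\<close>

lemma maximal_leakage_eq_infinity:
  fixes MX PX :: "'x measure" and MY PY :: "'y measure"
  assumes pXY: "prob_space PXY" and setsXY[measurable_cong]: "sets PXY = sets (MX \<Otimes>\<^sub>M MY)"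
    and PX: "PX = distr PXY MX fst" and PY: "PY = distr PXY MY snd"
    and nac: "\<not> absolutely_continuous (PX \<Otimes>\<^sub>M PY) PXY"
  shows "maximal_leakage MX MY PXY = \<infinity>"
proof -
  interpret PXY: prob_space PXY by fact
  have fst': "fst \<in> measurable PXY MX" and snd'[measurable]: "snd \<in> measurable PXY MY"
    using setsXY by (simp_all cong: measurable_cong_sets)
  interpret PX: prob_space PX unfolding PX by (rule PXY.prob_space_distr[OF fst'])
  interpret PY: prob_space PY unfolding PY by (rule PXY.prob_space_distr[OF snd'])
  have sX[measurable_cong]: "sets PX = sets MX" and sY[measurable_cong]: "sets PY = sets MY"
    and spY: "space PY = space MY" by (simp_all add: PX PY)
  interpret PP: pair_prob_space PX PY ..
  have sP: "sets (PX \<Otimes>\<^sub>M PY) = sets (MX \<Otimes>\<^sub>M MY)" by (rule sets_pair_measure_cong[OF sX sY])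
  have spXY: "space PXY = space MX \<times> space MY"
    using sets_eq_imp_space_eq[OF setsXY] by (simp add: space_pair_measure)
  obtain N where N: "N \<in> null_sets (PX \<Otimes>\<^sub>M PY)" "N \<notin> null_sets PXY"
    using nac by (auto simp: absolutely_continuous_def)
  have NM: "N \<in> sets (MX \<Otimes>\<^sub>M MY)" using N(1) sP by (auto simp: null_sets_def)
  have N0: "measure (PX \<Otimes>\<^sub>M PY) N = 0" using N(1) by (simp add: null_sets_def measure_def)
  define \<delta> where "\<delta> = measure PXY N"
  have \<delta>: "\<delta> > 0" using N(2) NM
    by (auto simp: \<delta>_def null_sets_def setsXY PXY.emeasure_eq_measure zero_less_measure_iff)
  have ge: "ln_ext (ennreal (K * \<delta> / 2)) \<le> maximal_leakage MX MY PXY" if K: "K > 0" for K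
  proof -
    \<comment> \<open>Replacing \<open>N\<close> by \<open>R\<close> loses \<open>e\<close>,
      discarding the \<open>y\<close> with large sections loses \<open>K * e\<close>; together this
      is \<open>\<delta> / 2\<close>.\<close>
    define e where "e = \<delta> / 2 / (1 + K)"
    have e: "e > 0" using \<delta> K by (simp add: e_def)
    obtain R where R: "R \<in> section_algebra MX MY"
      "measure PXY (sym_diff R N) < e" "measure (PX \<Otimes>\<^sub>M PY) (sym_diff R N) < e"
      using finite_measures_approx_algebra[OF PXY.finite_measure_axioms PP.P.finite_measure_axioms
          setsXY[unfolded sets_pair_eq_section_algebra] sP[unfolded sets_pair_eq_section_algebra[of MX]]
          algebra_section_algebra NM[unfolded sets_pair_eq_section_algebra] e] by blast
    have RM[measurable]: "R \<in> sets (MX \<Otimes>\<^sub>M MY)" using R(1) by (rule section_algebra_measurable)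
    obtain s where s: "simple_function MY s" "\<And>y. y \<in> space MY \<Longrightarrow> s y \<in> sets MX"
      and Rs: "R = {(x, y). y \<in> space MY \<and> x \<in> s y}"
      using R(1) by (auto simp: section_algebra_def)
    have [measurable]: "s \<in> measurable MY (count_space UNIV)" using s(1) by (rule measurable_simple_function)
    \<comment> \<open>For these \<open>y\<close>, \<open>K\<close> times the indicator of the
      section has integral at most \<open>1\<close>.\<close>
    define W where "W = {y \<in> space MY. measure PX (s y) \<le> 1 / K}"
    have W[measurable]: "W \<in> sets MY"
    proof -
      have "(\<lambda>y. measure PX (s y)) \<in> borel_measurable MY"
        by (rule measurable_compose[of s MY "count_space UNIV"]) auto
      then show ?thesis unfolding W_def by measurable
    qed
    \<comment> \<open>Markov's inequality for the measure of the section. As \<open>N\<close> is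
      product-null, \<open>R\<close> has product measure at most \<open>e\<close>.\<close>
    have "ennreal (1 / K) * emeasure PY (space MY - W) = (\<integral>\<^sup>+y. ennreal (1 / K) * indicator (space MY - W) y \<partial>PY)"
      by (subst nn_integral_cmult_indicator) auto
    also have "\<dots> \<le> (\<integral>\<^sup>+y. emeasure PX ((\<lambda>x. (x, y)) -` R) \<partial>PY)"
    proof (rule nn_integral_mono)
      fix y assume "y \<in> space PY"
      then show "ennreal (1 / K) * indicator (space MY - W) y \<le> emeasure PX ((\<lambda>x. (x, y)) -` R)"
        by (auto simp: indicator_def W_def Rs spY PX.emeasure_eq_measure intro!: ennreal_leI)
    qed
    also have "\<dots> = emeasure (PX \<Otimes>\<^sub>M PY) R"
      by (rule PP.emeasure_pair_measure_alt2[symmetric]) simp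
    also have "\<dots> \<le> ennreal e"
      using PP.P.measure_le_sym_diff[of R N] R(3) N0 RM NM
      by (auto simp: sP PP.P.emeasure_eq_measure intro!: ennreal_leI)
    finally have "1 / K * measure PY (space MY - W) \<le> e"
      using K e by (simp add: PY.emeasure_eq_measure flip: ennreal_mult)
    then have PYW: "measure PY (space MY - W) \<le> K * e" using K by (simp add: field_simps)
    let ?T = "R \<inter> snd -` W"
    have TM: "?T \<in> sets PXY"
    proof -
      have "R \<inter> (snd -` W \<inter> space PXY) \<in> sets PXY"
        by (intro sets.Int measurable_sets[OF snd' W]) (simp add: setsXY)
      also have "R \<inter> (snd -` W \<inter> space PXY) = ?T"
        using sets.sets_into_space[OF RM] by (auto simp: spXY space_pair_measure)
      finally show ?thesis .
    qed
    have "\<delta> \<le> measure PXY R + e"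
      using PXY.measure_le_sym_diff[of N R] R(2) RM NM by (simp add: \<delta>_def setsXY Un_commute)
    moreover have "measure PXY R \<le> measure PXY ?T + measure PXY (snd -` (space MY - W) \<inter> space PXY)"
    proof (rule order_trans[OF PXY.finite_measure_mono measure_Un_le])
      show "R \<subseteq> ?T \<union> (snd -` (space MY - W) \<inter> space PXY)"
        using sets.sets_into_space[OF RM] by (auto simp: spXY space_pair_measure)
      show "snd -` (space MY - W) \<inter> space PXY \<in> sets PXY" by (intro measurable_sets[OF snd']) auto
      with TM show "?T \<union> (snd -` (space MY - W) \<inter> space PXY) \<in> sets PXY" by auto
    qed (rule TM)
    moreover have "measure PXY (snd -` (space MY - W) \<inter> space PXY) = measure PY (space MY - W)"
      unfolding PY by (rule measure_distr[symmetric, OF snd']) simp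
    ultimately have "\<delta> \<le> measure PXY ?T + (1 + K) * e" using PYW by (simp add: algebra_simps)
    moreover have "(1 + K) * e = \<delta> / 2"
      unfolding e_def using K by (intro nonzero_mult_div_cancel_left[THEN trans[OF times_divide_eq_right]]) auto
    ultimately have T: "\<delta> / 2 \<le> measure PXY ?T" by linarith
    \<comment> \<open>The finitely many sections are numbered by \<open>b\<close>; the guess is the
      number \<open>k y\<close> of the section at \<open>y\<close>, and \<open>c\<close> recovers
      the section from its number.\<close>
    have fin: "finite (s ` space MY)" using s(1) by (simp add: simple_function_def)
    then obtain b where b: "bij_betw b (s ` space MY) {0..<card (s ` space MY)}"
      using ex_bij_betw_finite_nat by blast
    define k where "k y = b (s y)" for y
    define c where "c i = inv_into (s ` space MY) b i" for i
    have ck: "c (k y) = s y" if "y \<in> space MY" for y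
      using b that by (auto simp: c_def k_def bij_betw_def)
    \<comment> \<open>The test discards large sections and makes the bounds hold at every index,
      including those that number no section, where \<open>c i\<close> is arbitrary.\<close>
    define w where "w i x = (if c i \<in> sets MX \<and> measure PX (c i) \<le> 1 / K then K * indicator (c i) x else 0)" for i x
    have "ln_ext (\<integral>\<^sup>+z. w (k (snd z)) (fst z) \<partial>PXY) \<le> maximal_leakage MX MY PXY"
    proof (rule maximal_leakage_ge[OF pXY setsXY])
      have "k \<in> measurable MY (count_space UNIV)" unfolding k_def
        by (rule measurable_compose[of s MY "count_space UNIV"]) auto
      moreover have "k y \<in> {0..<card (s ` space MY)}" if "y \<in> space MY" for y
        using b that by (auto simp: k_def bij_betw_def)
      ultimately show "k \<in> measurable MY (count_space {..<card (s ` space MY)})"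
        by (subst measurable_count_space_eq2)
           (auto intro: measurable_sets[of k MY "count_space UNIV"])
      show "w i \<in> borel_measurable MX" for i
        by (cases "c i \<in> sets MX") (auto simp: w_def[abs_def])
      show "0 \<le> w i x" "w i x \<le> K" for i x using K by (auto simp: w_def indicator_def)
      show "(\<integral>\<^sup>+x. ennreal (w i x) \<partial>distr PXY MX fst) \<le> 1" for i
      proof (cases "c i \<in> sets MX \<and> measure PX (c i) \<le> 1 / K")
        case True
        then have "(\<integral>\<^sup>+x. ennreal (w i x) \<partial>PX) = (\<integral>\<^sup>+x. ennreal K * indicator (c i) x \<partial>PX)"
          using K by (intro nn_integral_cong) (auto simp: w_def indicator_def)
        also have "\<dots> = ennreal (K * measure PX (c i))"
          using K True by (simp add: nn_integral_cmult_indicator sX PX.emeasure_eq_measure ennreal_mult)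
        also have "\<dots> \<le> 1"
          using K True ennreal_leI[of "K * measure PX (c i)" 1] by (simp add: pos_le_divide_eq mult.commute)
        finally show ?thesis by (simp add: PX)
      next
        case False
        then have "w i = (\<lambda>_. 0)" by (auto simp: w_def)
        then show ?thesis by simp
      qed
    qed
    also have "(\<integral>\<^sup>+z. w (k (snd z)) (fst z) \<partial>PXY) = (\<integral>\<^sup>+z. ennreal K * indicator ?T z \<partial>PXY)"
    proof (rule nn_integral_cong)
      fix z assume "z \<in> space PXY"
      then obtain x y where z: "z = (x, y)" "y \<in> space MY" by (auto simp: spXY)
      then have "z \<in> ?T \<longleftrightarrow> x \<in> s y \<and> measure PX (s y) \<le> 1 / K" by (simp add: Rs W_def)
      then show "ennreal (w (k (snd z)) (fst z)) = ennreal K * indicator ?T z"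
        using s(2)[OF z(2)] by (simp add: z(1) w_def ck[OF z(2)] indicator_def)
    qed
    also have "\<dots> = ennreal (K * measure PXY ?T)"
      using K TM by (simp add: nn_integral_cmult_indicator PXY.emeasure_eq_measure ennreal_mult)
    finally have "ln_ext (ennreal (K * measure PXY ?T)) \<le> maximal_leakage MX MY PXY" .
    moreover have "ln_ext (ennreal (K * \<delta> / 2)) \<le> ln_ext (ennreal (K * measure PXY ?T))"
      using mult_left_mono[OF T, of K] K by (intro ln_ext_mono ennreal_leI) simp
    ultimately show ?thesis by (rule order_trans[rotated])
  qed
  \<comment> \<open>As \<open>K\<close> runs through the positive integers,
    \<open>K * \<delta> / 2\<close> is unbounded.\<close>
  have "ln_ext \<infinity> \<le> maximal_leakage MX MY PXY"
  proof (rule ln_ext_le_SUP)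
    show "ln_ext (ennreal (real (Suc n) * \<delta> / 2)) \<le> maximal_leakage MX MY PXY" for n by (rule ge) simp
    have "x \<le> (SUP n. ennreal (real (Suc n) * \<delta> / 2))" if "x < \<infinity>" for x :: ennreal
    proof (cases x)
      case (real t)
      obtain n where "t / (\<delta> / 2) < real n" using reals_Archimedean2 by blast
      then have "t \<le> real (Suc n) * \<delta> / 2" using \<delta> by (simp add: field_simps)
      then show ?thesis using real by (intro SUP_upper2[of n]) (auto intro!: ennreal_leI)
    qed (use that in simp)
    then show "\<infinity> \<le> (SUP n. ennreal (real (Suc n) * \<delta> / 2))" by (rule dense_le)
  qed
  then show ?thesis by (simp add: ln_ext_def)
qed

theorem theorem7:
  fixes MX PX :: "'x measure" and MY PY :: "'y measure" and PXY :: "('x \<times> 'y) measure"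
  assumes "prob_space PXY"
    and "sets PXY = sets (MX \<Otimes>\<^sub>M MY)"
    and "PX = distr PXY MX fst"
    and "PY = distr PXY MY snd"
  shows "(absolutely_continuous (PX \<Otimes>\<^sub>M PY) PXY \<and> countably_generated MX \<longrightarrow>
            (\<forall>f \<in> borel_measurable (PX \<Otimes>\<^sub>M PY).
               (AE z in PX \<Otimes>\<^sub>M PY. f z = RN_deriv (PX \<Otimes>\<^sub>M PY) PXY z) \<longrightarrow>
               maximal_leakage MX MY PXY
                 = ln_ext (\<integral>\<^sup>+ y. esssup PX (\<lambda>x. f (x, y)) \<partial>PY)))
         \<and> (\<not> absolutely_continuous (PX \<Otimes>\<^sub>M PY) PXY \<longrightarrow> maximal_leakage MX MY PXY = \<infinity>)"
proof (intro conjI impI ballI)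
  fix f assume ac: "absolutely_continuous (PX \<Otimes>\<^sub>M PY) PXY \<and> countably_generated MX"
    and f: "f \<in> borel_measurable (PX \<Otimes>\<^sub>M PY)"
    and AE: "AE z in PX \<Otimes>\<^sub>M PY. f z = RN_deriv (PX \<Otimes>\<^sub>M PY) PXY z"
  interpret PXY: prob_space PXY by fact
  have fst': "fst \<in> measurable PXY MX" and snd': "snd \<in> measurable PXY MY"
    using assms(2) by (simp_all cong: measurable_cong_sets)
  interpret PX: prob_space PX unfolding assms(3) by (rule PXY.prob_space_distr[OF fst'])
  interpret PY: prob_space PY unfolding assms(4) by (rule PXY.prob_space_distr[OF snd'])
  interpret PP: pair_prob_space PX PY ..
  \<comment> \<open>Every version of the derivative is a density of \<open>PXY\<close>, the form in
    which both bounds take \<open>f\<close>.\<close>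
  have "density (PX \<Otimes>\<^sub>M PY) f = density (PX \<Otimes>\<^sub>M PY) (RN_deriv (PX \<Otimes>\<^sub>M PY) PXY)"
    using f AE by (intro density_cong) auto
  also have "\<dots> = PXY"
    using ac assms by (intro PP.P.density_RN_deriv) (auto intro!: sets_pair_measure_cong)
  finally have dens: "density (PX \<Otimes>\<^sub>M PY) f = PXY" .
  show "maximal_leakage MX MY PXY = ln_ext (\<integral>\<^sup>+ y. esssup PX (\<lambda>x. f (x, y)) \<partial>PY)"
  proof (rule antisym)
    show "maximal_leakage MX MY PXY \<le> ln_ext (\<integral>\<^sup>+ y. esssup PX (\<lambda>x. f (x, y)) \<partial>PY)"
      unfolding maximal_leakage_def using guessing_gain_le[OF assms f dens] by (auto intro!: Sup_least)
    show "ln_ext (\<integral>\<^sup>+ y. esssup PX (\<lambda>x. f (x, y)) \<partial>PY) \<le> maximal_leakage MX MY PXY"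
      using ac by (intro ln_ext_esssup_le_maximal_leakage[OF assms f dens]) simp
  qed
next
  assume "\<not> absolutely_continuous (PX \<Otimes>\<^sub>M PY) PXY"
  then show "maximal_leakage MX MY PXY = \<infinity>" by (rule maximal_leakage_eq_infinity[OF assms])
qed

end
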